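(* Let $\mathbf w^0$ be the vector with $\mathbf w^0_i=\delta_{0i}$, $i\in\mathbb Z$ (type $A_\infty$). For $Y\in\mathcal Y$ and $k\in\mathbb Z$: $F_k\mathbf 1_{X_Y}=\mathbf 1_{X_{Y'}}$ where $Y'\in\mathcal Y$ satisfies $\mathbf v_{Y'}=\mathbf v_Y+\mathbf e^k$ if such a $Y'$ exists, and $F_k\mathbf 1_{X_Y}=0$ otherwise. Also, $E_k\mathbf 1_{X_Y}=\mathbf 1_{X_{Y''}}$ where $Y''\in\mathcal Y$ satisfies $\mathbf v_{Y''}=\mathbf v_Y-\mathbf e^k$ if such a $Y''$ exists, and $E_k\mathbf 1_{X_Y}=0$ otherwise.
   Context: Quiver varieties. $I=\mathbb Z$. For every $i\in I$ there is an arrow $i\to i-1$ (with $\mathrm{out}=i$, $\mathrm{in}=i-1$; these form $\Omega$) and an opposite arrow $i\leftarrow i-1$ (with $\mathrm{out}=i-1$, $\mathrm{in}=i$; these form $\bar\Omega$); $H=\Omega\sqcup\bar\Omega$, $h\mapsto\bar h$ interchanges $i\to i-1$ and $i\leftarrow i-1$; $\varepsilon=1$ on $\Omega$ and $-1$ on $\bar\Omega$. For a finite-dimensional $I$-graded complex vector space $\mathbf V$ of graded dimension $\mathbf v$: $\mathbf E_{\mathbf V}=\bigoplus_{h\in H}\mathrm{Hom}(\mathbf V_{\mathrm{out}(h)},\mathbf V_{\mathrm{in}(h)})$; $G_{\mathbf V}=\prod_i\mathrm{Aut}(\mathbf V_i)$ acts by $(gx)_h=g_{\mathrm{in}(h)}x_hg_{\mathrm{out}(h)}^{-1}$;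 $\psi_i(x)=\sum_{\mathrm{in}(h)=i}\varepsilon(h)x_hx_{\bar h}$. $\Lambda_{\mathbf V}$ is the set of $x\in\mathbf E_{\mathbf V}$ with all $\psi_i(x)=0$ and which are nilpotent (all compositions along sufficiently long composable sequences of arrows vanish). With $\mathbf W$ of graded dimension $\mathbf w$, $\Lambda(\mathbf v,\mathbf w)=\Lambda_{\mathbf V}\times\bigoplus_i\mathrm{Hom}(\mathbf V_i,\mathbf W_i)$; $\Lambda(\mathbf v,\mathbf w)^{\mathrm{st}}$ is the set of $(x,j)$ such that no nonzero graded $x$-stable $\mathbf S\subset\mathbf V$ satisfies $j(\mathbf S)=0$; $\mathcal L(\mathbf v,\mathbf w)=\Lambda(\mathbf v,\mathbf w)^{\mathrm{st}}/G_{\mathbf V}$, where $g(x,j)=(gx,(j_ig_i^{-1}))$. Operators. $M(\mathcal L(\mathbf v,\mathbf w))$ is the space of constructible functions on $\mathcal L(\mathbf v,\mathbf w)$; $\mathbf 1_X$ is the function equal to $1$ on $X$ and $0$ elsewhere; $\mathbf e^k$ is the $k$-th unit vector. Let $\mathcal F$ be the variety of $G_{\mathbf V}$-orbits of triples $(x,j,\mathbf S)$ with $(x,j)\in\Lambda(\mathbf v,\mathbf w)^{\mathrm{st}}$ and $\mathbf S\subset\mathbf V$ a graded $x$-stable subspace of dimension $\mathbf v-\mathbf e^k$, with maps $\pi_1:\mathcal F\to\mathcal L(\mathbf v-\mathbf e^k,\mathbf w)$, $(x,j,\mathbf S)\mapsto(x|_{\mathbf S},j|_{\mathbf S})$, and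 $\pi_2:\mathcal F\to\mathcal L(\mathbf v,\mathbf w)$, $(x,j,\mathbf S)\mapsto(x,j)$. With $\pi^*$ the pullback of functions and $\pi_!$ the linear pushforward given by $\pi_!(\mathbf 1_Y)(y)=\chi(\pi^{-1}(y)\cap Y)$ ($\chi$ the Euler characteristic), put $E_k:M(\mathcal L(\mathbf v,\mathbf w))\to M(\mathcal L(\mathbf v-\mathbf e^k,\mathbf w))$, $E_kf=(\pi_1)_!\pi_2^*f$, and $F_k:M(\mathcal L(\mathbf v-\mathbf e^k,\mathbf w))\to M(\mathcal L(\mathbf v,\mathbf w))$, $F_kg=(\pi_2)_!\pi_1^*g$. The operators $E_k,F_k$, together with $H_k$ acting on $M(\mathcal L(\mathbf v,\mathbf w))$ by the scalar $(\mathbf w-C\mathbf v)_k=\mathbf w_k-2\mathbf v_k+\mathbf v_{k-1}+\mathbf v_{k+1}$, define on the space $L(\mathbf w)$ generated by the $F_k$ from the constant function $1$ on $\mathcal L(\mathbf 0,\mathbf w)$ the irreducible highest weight representation of highest weight $\mathbf w$ (Nakajima). Young diagrams. $\mathcal Y$ is the set of Young diagrams $Y=[l_1,\dots,l_s]$ (weakly decreasing sequences of positive integers, $s\ge0$). Each $\mathcal L(\mathbf v,\mathbf w^0)$ is empty or a point. For $Y\in\mathcal Y$ let $\mathbf v_Y$ be the vector whose $r$-th component is $\#\{i : 1-i\le r\le l_i-i,\ 1\le i\le s\}$; then $X_Y=\mathcal L(\mathbf v_Y,\mathbf w^0)$ is a point, and $Y\mapsto X_Y$ is a bijection from $\mathcal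 Y$ onto the set of nonempty $\mathcal L(\mathbf v,\mathbf w^0)$. *)

theory Defs
  imports
    "HOL-Homology.Homology"
    "Jordan_Normal_Form.VS_Connect"
begin

text \<open>
  The vertex set is the set of integers. The arrow \<open>Down i\<close> is $i \to i-1$ and \<open>Up i\<close> is the
  opposite arrow $i-1 \to i$. The graded space of graded dimension \<open>v\<close> is taken to be
  $\bigoplus_i \mathbf{C}^{v_i}$. The quotients below depend only on \<open>v\<close>.
\<close>

datatype arrow = Down int | Up int

fun src :: "arrow \<Rightarrow> int" where
  "src (Down i) = i"
| "src (Up i) = i - 1"

fun tgt :: "arrow \<Rightarrow> int" where
  "tgt (Down i) = i - 1"
| "tgt (Up i) = i"

fun opp :: "arrow \<Rightarrow> arrow" where
  "opp (Down i) = Up i"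
| "opp (Up i) = Down i"

fun eps :: "arrow \<Rightarrow> complex" where
  "eps (Down i) = 1"
| "eps (Up i) = - 1"

type_synonym gdim = "int \<Rightarrow> nat"
type_synonym qrep = "arrow \<Rightarrow> complex mat"
type_synonym gmap = "int \<Rightarrow> complex mat"
type_synonym gsub = "int \<Rightarrow> complex vec set"

definition gdims :: "gdim set" where
  "gdims = {v. finite {i. v i \<noteq> 0}}"

definition unit_gdim :: "int \<Rightarrow> gdim" where
  "unit_gdim k = (\<lambda>i. if i = k then 1 else 0)"

definition gmaps :: "gdim \<Rightarrow> gdim \<Rightarrow> gmap set" where
  "gmaps v w = {j. \<forall>i. j i \<in> carrier_mat (w i) (v i)}"

definition rep_space :: "gdim \<Rightarrow> qrep set" where
  "rep_space v = {x. \<forall>h. x h \<in> carrier_mat (v (tgt h)) (v (src h))}"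

text \<open>The sum of matrices is formed entrywise, since matrices of all sizes share one type.\<close>

definition moment :: "gdim \<Rightarrow> qrep \<Rightarrow> int \<Rightarrow> complex mat" where
  "moment v x i =
     mat (v i) (v i) (\<lambda>ab. \<Sum>h | tgt h = i. eps h * (x h * x (opp h)) $$ ab)"

fun path_map :: "qrep \<Rightarrow> arrow list \<Rightarrow> complex mat" where
  "path_map x [h] = x h"
| "path_map x (h # h' # hs) = path_map x (h' # hs) * x h"

definition nilpotent_rep :: "gdim \<Rightarrow> qrep \<Rightarrow> bool" where
  "nilpotent_rep v x \<longleftrightarrow>
     (\<exists>N. \<forall>hs. hs \<noteq> [] \<and> length hs \<ge> N \<and> successively (\<lambda>h h'. tgt h = src h') hs \<longrightarrow>
        path_map x hs = 0\<^sub>m (v (tgt (last hs))) (v (src (hd hs))))"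

definition Lambda_V :: "gdim \<Rightarrow> qrep set" where
  "Lambda_V v = {x \<in> rep_space v. (\<forall>i. moment v x i = 0\<^sub>m (v i) (v i)) \<and> nilpotent_rep v x}"

definition Lambda :: "gdim \<Rightarrow> gdim \<Rightarrow> (qrep \<times> gmap) set" where
  "Lambda v w = Lambda_V v \<times> gmaps v w"

definition graded_subspace :: "gdim \<Rightarrow> gsub \<Rightarrow> bool" where
  "graded_subspace v S \<longleftrightarrow>
     (\<forall>i. VectorSpace.subspace class_ring (S i) (module_vec TYPE(complex) (v i)))"

definition gdim_of :: "gdim \<Rightarrow> gsub \<Rightarrow> gdim" where
  "gdim_of v S =
     (\<lambda>i. vectorspace.dim class_ring ((module_vec TYPE(complex) (v i))\<lparr>carrier := S i\<rparr>))"

definition rep_stable :: "qrep \<Rightarrow> gsub \<Rightarrow> bool" where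
  "rep_stable x S \<longleftrightarrow> (\<forall>h. \<forall>s \<in> S (src h). x h *\<^sub>v s \<in> S (tgt h))"

definition Lambda_st :: "gdim \<Rightarrow> gdim \<Rightarrow> (qrep \<times> gmap) set" where
  "Lambda_st v w =
     {(x, j) \<in> Lambda v w.
        \<forall>S. graded_subspace v S \<and> rep_stable x S \<and> (\<forall>i. \<forall>s \<in> S i. j i *\<^sub>v s = 0\<^sub>v (w i))
          \<longrightarrow> (\<forall>i. S i = {0\<^sub>v (v i)})}"

abbreviation End_ring :: "gdim \<Rightarrow> int \<Rightarrow> complex mat ring" where
  "End_ring v i \<equiv> ring_mat TYPE(complex) (v i) ()"

definition G_V :: "gdim \<Rightarrow> gmap set" where
  "G_V v = {g. \<forall>i. g i \<in> Units (End_ring v i)}"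

definition act :: "gdim \<Rightarrow> gmap \<Rightarrow> qrep \<times> gmap \<Rightarrow> qrep \<times> gmap" where
  "act v g = (\<lambda>(x, j).
     (\<lambda>h. g (tgt h) * x h * inv\<^bsub>End_ring v (src h)\<^esub> (g (src h)),
      \<lambda>i. j i * inv\<^bsub>End_ring v i\<^esub> (g i)))"

definition orbit_of :: "gdim \<Rightarrow> qrep \<times> gmap \<Rightarrow> (qrep \<times> gmap) set" where
  "orbit_of v p = (\<lambda>g. act v g p) ` G_V v"

definition quiver_variety :: "gdim \<Rightarrow> gdim \<Rightarrow> (qrep \<times> gmap) set set" where
  "quiver_variety v w = orbit_of v ` Lambda_st v w"

inductive_set regular_functions :: "gdim \<Rightarrow> gdim \<Rightarrow> (qrep \<times> gmap \<Rightarrow> complex) set"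
  for v w :: gdim where
  const: "(\<lambda>_. c) \<in> regular_functions v w"
| coord_x: "a < v (tgt h) \<Longrightarrow> b < v (src h) \<Longrightarrow> (\<lambda>(x, j). x h $$ (a, b)) \<in> regular_functions v w"
| coord_j: "a < w i \<Longrightarrow> b < v i \<Longrightarrow> (\<lambda>(x, j). j i $$ (a, b)) \<in> regular_functions v w"
| add: "f \<in> regular_functions v w \<Longrightarrow> g \<in> regular_functions v w \<Longrightarrow>
    (\<lambda>p. f p + g p) \<in> regular_functions v w"
| mult: "f \<in> regular_functions v w \<Longrightarrow> g \<in> regular_functions v w \<Longrightarrow>
    (\<lambda>p. f p * g p) \<in> regular_functions v w"

text \<open>
  The quiver variety is a geometric quotient, so its Zariski topology is the quotient topology:
  a set of orbits is closed iff its preimage, the union of these orbits, is closed.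
\<close>

definition zariski_closed :: "gdim \<Rightarrow> gdim \<Rightarrow> (qrep \<times> gmap) set set \<Rightarrow> bool" where
  "zariski_closed v w Z \<longleftrightarrow> Z \<subseteq> quiver_variety v w \<and>
     (\<exists>P \<subseteq> regular_functions v w. \<Union>Z = {p \<in> Lambda_st v w. \<forall>f \<in> P. f p = 0})"

inductive_set constructible_sets :: "gdim \<Rightarrow> gdim \<Rightarrow> (qrep \<times> gmap) set set set"
  for v w :: gdim where
  closed: "zariski_closed v w Z \<Longrightarrow> Z \<in> constructible_sets v w"
| compl: "A \<in> constructible_sets v w \<Longrightarrow> quiver_variety v w - A \<in> constructible_sets v w"
| union: "A \<in> constructible_sets v w \<Longrightarrow> B \<in> constructible_sets v w \<Longrightarrow>
    A \<union> B \<in> constructible_sets v w"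

text \<open>Functions on a quiver variety are extended by zero to the whole type.\<close>

definition constructible_functions ::
    "gdim \<Rightarrow> gdim \<Rightarrow> ((qrep \<times> gmap) set \<Rightarrow> complex) set" where
  "constructible_functions v w =
     {f. (\<forall>y. y \<notin> quiver_variety v w \<longrightarrow> f y = 0) \<and> finite (range f) \<and>
         (\<forall>a. {y \<in> quiver_variety v w. f y = a} \<in> constructible_sets v w)}"

text \<open>
  The rank of an abelian group is the largest size of a finite independent subset. It is
  meaningful only if these sizes are bounded.
\<close>

definition int_independent :: "('a, 'b) monoid_scheme \<Rightarrow> 'a set \<Rightarrow> bool" where
  "int_independent G B \<longleftrightarrow> finite B \<and> B \<subseteq> carrier G \<and>
     (\<forall>c :: 'a \<Rightarrow> int. finprod G (\<lambda>b. b [^]\<^bsub>G\<^esub> c b) B = \<one>\<^bsub>G\<^esub> \<longrightarrow> (\<forall>b \<in> B. c b = 0))"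

definition group_rank :: "('a, 'b) monoid_scheme \<Rightarrow> nat" where
  "group_rank G = Sup (card ` {B. int_independent G B})"

definition betti :: "nat \<Rightarrow> 'a topology \<Rightarrow> nat" where
  "betti p X = group_rank (homology_group (int p) X)"

definition euler_char :: "'a topology \<Rightarrow> int" where
  "euler_char X = (\<Sum>p | betti p X \<noteq> 0. (- 1) ^ p * int (betti p X))"

text \<open>
  The linear extension of $1_Y \mapsto (y \mapsto \chi(\pi^{-1}(y) \cap Y))$, obtained by writing
  \<open>f\<close> as the sum of $a \cdot 1_{f^{-1}(a)}$ over its finitely many values \<open>a\<close>. On constructible
  subsets of complex varieties the Euler characteristic of singular homology is additive.
\<close>

definition pushforward ::
    "'a topology \<Rightarrow> ('a \<Rightarrow> 'b) \<Rightarrow> ('a \<Rightarrow> complex) \<Rightarrow> 'b \<Rightarrow> complex" where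
  "pushforward T \<pi> f y =
     (\<Sum>a \<in> f ` topspace T.
        a * of_int (euler_char (subtopology T {z \<in> topspace T. \<pi> z = y \<and> f z = a})))"

text \<open>
  The correspondence is indexed by \<open>u\<close>, the graded dimension of the subspace; the ambient graded
  dimension is \<open>raise k u\<close>, which is $u + e^k$.
\<close>

definition raise :: "int \<Rightarrow> gdim \<Rightarrow> gdim" where
  "raise k u = (\<lambda>i. u i + unit_gdim k i)"

definition lower :: "int \<Rightarrow> gdim \<Rightarrow> gdim" where
  "lower k v = (\<lambda>i. v i - unit_gdim k i)"

definition hecke_triples :: "gdim \<Rightarrow> gdim \<Rightarrow> int \<Rightarrow> ((qrep \<times> gmap) \<times> gsub) set" where
  "hecke_triples u w k =
     {((x, j), S). (x, j) \<in> Lambda_st (raise k u) w \<and> graded_subspace (raise k u) S \<and>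
        gdim_of (raise k u) S = u \<and> rep_stable x S}"

definition triple_orbit ::
    "gdim \<Rightarrow> (qrep \<times> gmap) \<times> gsub \<Rightarrow> ((qrep \<times> gmap) \<times> gsub) set" where
  "triple_orbit v = (\<lambda>(p, S). (\<lambda>g. (act v g p, \<lambda>i. (\<lambda>s. g i *\<^sub>v s) ` S i)) ` G_V v)"

definition hecke :: "gdim \<Rightarrow> gdim \<Rightarrow> int \<Rightarrow> ((qrep \<times> gmap) \<times> gsub) set set" where
  "hecke u w k = triple_orbit (raise k u) ` hecke_triples u w k"

definition gframes :: "gdim \<Rightarrow> gdim \<Rightarrow> gmap set" where
  "gframes u v = {\<iota> \<in> gmaps u v. \<forall>i. inj_on (\<lambda>s. \<iota> i *\<^sub>v s) (carrier_vec (u i))}"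

definition gimage :: "gdim \<Rightarrow> gmap \<Rightarrow> gsub" where
  "gimage u \<iota> = (\<lambda>i. (\<lambda>s. \<iota> i *\<^sub>v s) ` carrier_vec (u i))"

text \<open>
  The class of $(x|_S, j|_S)$: all pairs obtained by transporting the restriction along an
  isomorphism from the standard graded space of dimension \<open>u\<close> onto \<open>S\<close>. These pairs form one
  orbit.
\<close>

definition \<pi>1 ::
    "gdim \<Rightarrow> gdim \<Rightarrow> int \<Rightarrow> ((qrep \<times> gmap) \<times> gsub) set \<Rightarrow> (qrep \<times> gmap) set" where
  "\<pi>1 u w k Q = {(x', j'). x' \<in> rep_space u \<and> j' \<in> gmaps u w \<and>
     (\<exists>x j S \<iota>. ((x, j), S) \<in> Q \<and> \<iota> \<in> gframes u (raise k u) \<and> gimage u \<iota> = S \<and>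
        (\<forall>h. x h * \<iota> (src h) = \<iota> (tgt h) * x' h) \<and> (\<forall>i. j i * \<iota> i = j' i))}"

definition \<pi>2 :: "((qrep \<times> gmap) \<times> gsub) set \<Rightarrow> (qrep \<times> gmap) set" where
  "\<pi>2 Q = fst ` Q"

text \<open>
  The classical topology of the correspondence. The set of triples $(x, j, \iota)$ with \<open>\<iota>\<close> a frame
  of a stable subspace lies in a finite-dimensional complex vector space and is a principal bundle
  over the variety of orbits, which therefore carries the quotient topology.
\<close>

definition quotient_topology :: "'a topology \<Rightarrow> 'b set \<Rightarrow> ('a \<Rightarrow> 'b) \<Rightarrow> 'b topology" where
  "quotient_topology X B q = topology (\<lambda>U. U \<subseteq> B \<and> openin X {x \<in> topspace X. q x \<in> U})"

lemma openin_quotient_topology: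
  "openin (quotient_topology X B q) U \<longleftrightarrow> U \<subseteq> B \<and> openin X {x \<in> topspace X. q x \<in> U}"
proof -
  have "istopology (\<lambda>U. U \<subseteq> B \<and> openin X {x \<in> topspace X. q x \<in> U})"
    unfolding istopology_def
  proof (intro conjI allI impI; (elim conjE)?)
    fix S T
    assume "openin X {x \<in> topspace X. q x \<in> S}" "openin X {x \<in> topspace X. q x \<in> T}"
    then have "openin X ({x \<in> topspace X. q x \<in> S} \<inter> {x \<in> topspace X. q x \<in> T})" by blast
    moreover have "{x \<in> topspace X. q x \<in> S} \<inter> {x \<in> topspace X. q x \<in> T} =
        {x \<in> topspace X. q x \<in> S \<inter> T}" by blast
    ultimately show "openin X {x \<in> topspace X. q x \<in> S \<inter> T}" by simp
  next
    fix \<K>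
    assume "\<forall>K\<in>\<K>. K \<subseteq> B \<and> openin X {x \<in> topspace X. q x \<in> K}"
    then have "openin X (\<Union>K\<in>\<K>. {x \<in> topspace X. q x \<in> K})" by blast
    moreover have "(\<Union>K\<in>\<K>. {x \<in> topspace X. q x \<in> K}) = {x \<in> topspace X. q x \<in> \<Union>\<K>}" by blast
    ultimately show "openin X {x \<in> topspace X. q x \<in> \<Union>\<K>}" by simp
  qed blast+
  then show ?thesis
    by (simp add: quotient_topology_def topology_inverse')
qed

definition entries :: "complex mat \<Rightarrow> nat \<times> nat \<Rightarrow> complex" where
  "entries A = (\<lambda>(a, b). if a < dim_row A \<and> b < dim_col A then A $$ (a, b) else 0)"

definition hecke_frames :: "gdim \<Rightarrow> gdim \<Rightarrow> int \<Rightarrow> ((qrep \<times> gmap) \<times> gmap) set" where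
  "hecke_frames u w k =
     {((x, j), \<iota>). (x, j) \<in> Lambda_st (raise k u) w \<and> \<iota> \<in> gframes u (raise k u) \<and>
        rep_stable x (gimage u \<iota>)}"

definition frame_topology :: "gdim \<Rightarrow> gdim \<Rightarrow> int \<Rightarrow> ((qrep \<times> gmap) \<times> gmap) topology" where
  "frame_topology u w k =
     pullback_topology (hecke_frames u w k)
       (\<lambda>((x, j), \<iota>). (\<lambda>h. entries (x h), \<lambda>i. entries (j i), \<lambda>i. entries (\<iota> i))) euclidean"

definition hecke_topology ::
    "gdim \<Rightarrow> gdim \<Rightarrow> int \<Rightarrow> ((qrep \<times> gmap) \<times> gsub) set topology" where
  "hecke_topology u w k =
     quotient_topology (frame_topology u w k) (hecke u w k)
       (\<lambda>(p, \<iota>). triple_orbit (raise k u) (p, gimage u \<iota>))"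

definition E_comp ::
    "gdim \<Rightarrow> gdim \<Rightarrow> int \<Rightarrow> ((qrep \<times> gmap) set \<Rightarrow> complex) \<Rightarrow> (qrep \<times> gmap) set \<Rightarrow> complex" where
  "E_comp u w k f =
     (\<lambda>y. if y \<in> quiver_variety u w
          then pushforward (hecke_topology u w k) (\<pi>1 u w k) (f \<circ> \<pi>2) y else 0)"

definition F_comp ::
    "gdim \<Rightarrow> gdim \<Rightarrow> int \<Rightarrow> ((qrep \<times> gmap) set \<Rightarrow> complex) \<Rightarrow> (qrep \<times> gmap) set \<Rightarrow> complex" where
  "F_comp u w k g =
     (\<lambda>y. if y \<in> quiver_variety (raise k u) w
          then pushforward (hecke_topology u w k) \<pi>2 (g \<circ> \<pi>1 u w k) y else 0)"

text \<open>
  The operators on the direct sum over all \<open>v\<close>, whose elements are functions on the disjoint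
  union of the quiver varieties. A component with a negative entry in its index is zero.
\<close>

definition total_functions :: "gdim \<Rightarrow> (gdim \<times> (qrep \<times> gmap) set \<Rightarrow> complex) set" where
  "total_functions w =
     {f. (\<forall>v \<in> gdims. (\<lambda>y. f (v, y)) \<in> constructible_functions v w) \<and>
         (\<forall>v y. v \<notin> gdims \<longrightarrow> f (v, y) = 0) \<and> finite {v. \<exists>y. f (v, y) \<noteq> 0}}"

definition E_op ::
    "gdim \<Rightarrow> int \<Rightarrow> (gdim \<times> (qrep \<times> gmap) set \<Rightarrow> complex) \<Rightarrow>
       gdim \<times> (qrep \<times> gmap) set \<Rightarrow> complex" where
  "E_op w k = (\<lambda>f \<in> total_functions w. \<lambda>(u, y).
     if u \<in> gdims then E_comp u w k (\<lambda>z. f (raise k u, z)) y else 0)"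

definition F_op ::
    "gdim \<Rightarrow> int \<Rightarrow> (gdim \<times> (qrep \<times> gmap) set \<Rightarrow> complex) \<Rightarrow>
       gdim \<times> (qrep \<times> gmap) set \<Rightarrow> complex" where
  "F_op w k = (\<lambda>g \<in> total_functions w. \<lambda>(v, y).
     if v \<in> gdims \<and> v k > 0 then F_comp (lower k v) w k (\<lambda>z. g (lower k v, z)) y else 0)"

definition young_diagrams :: "nat list set" where
  "young_diagrams = {Y. sorted_wrt (\<ge>) Y \<and> (\<forall>l \<in> set Y. l > 0)}"

text \<open>Rows are numbered from 1, so $l_i$ is \<open>Y ! (i - 1)\<close>.\<close>

definition young_gdim :: "nat list \<Rightarrow> gdim" where
  "young_gdim Y = (\<lambda>r. card {i. 1 \<le> i \<and> i \<le> length Y \<and>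
     1 - int i \<le> r \<and> r \<le> int (Y ! (i - 1)) - int i})"

definition w0 :: gdim where
  "w0 = (\<lambda>i. if i = 0 then 1 else 0)"

definition X_Y :: "nat list \<Rightarrow> (gdim \<times> (qrep \<times> gmap) set) set" where
  "X_Y Y = {young_gdim Y} \<times> quiver_variety (young_gdim Y) w0"

end

theory Submission
  imports Defs
begin

text \<open>
  Write $a$ for the sum of the maps along the arrows \<open>Down i\<close> and $b$ for the sum of the maps along
  the arrows \<open>Up i\<close>. The equations $\psi_i(x) = 0$ say that $a$ and $b$ commute, so $\mathbf V$ is a
  graded module over $\mathbf C[a,b]$, where $a$ has degree $-1$ and $b$ has degree $1$. Since
  $\mathbf W$ is a line in degree $0$, the map $j$ is a single covector on $\mathbf V_0$, and
  stability means that this covector generates the dual module. Hence $\mathbf V^*$ is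
  $\mathbf C[a,b]$ modulo a homogeneous ideal. In each degree the polynomials are a fixed power of
  $a$ or of $b$ times a polynomial in $ab$, and $ab$ acts nilpotently, so the ideal is generated by
  monomials: the first $v_i$ covectors \<open>covec i m\<close>, obtained from $j$ by the shortest path from $i$
  to $0$ preceded by \<open>m\<close> loops at \<open>i\<close>, form a basis of $\mathbf V_i^*$, and all later ones vanish.
  In these coordinates every arrow becomes the truncated shift \<open>can_rep\<close>, which depends on \<open>v\<close>
  alone. So all stable points of dimension \<open>v\<close> form one orbit (\<open>quiver_variety_w0_subset\<close>), and
  one exists iff no truncation happens, that is, iff \<open>v\<close> is \<open>admissible\<close>
  (\<open>stable_point.dims_admissible\<close>, \<open>can_rep_in_Lambda_st\<close>). The admissible vectors of finite
  support are exactly the vectors of diagonal lengths of Young diagrams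
  (\<open>young_gdim_admissible\<close>, \<open>admissible_eq_young_gdim\<close>).

  Now let $v = u + e^k$ with \<open>u\<close> and \<open>v\<close> admissible. A stable subspace of dimension \<open>u\<close> is everything
  away from \<open>k\<close> and a hyperplane at \<open>k\<close>. In the coordinates above the image of any arrow into \<open>k\<close>
  contains all basis vectors at \<open>k\<close> except possibly the last one, so this hyperplane is forced
  (\<open>coord_image_stable_subspace\<close>). Therefore the correspondence is one point
  (\<open>hecke_eq\<close>), lying over the unique points of both quiver varieties (\<open>\<pi>1_hecke_point\<close>,
  \<open>\<pi>2_hecke_point\<close>). The Euler characteristic of a one-point space is $1$
  (\<open>euler_char_singleton\<close>), so both operators send the indicator function of a point to that of the
  neighbouring point if the latter exists. If it does not exist, the target varieties are empty and
  the result is $0$.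
\<close>

text \<open>
  Throughout, \<open>$\<close> selects an entry of a vector of variable length.
\<close>

no_notation Finite_Cartesian_Product.vec.vec_nth (infixl "$" 90)

section \<open>The Euler characteristic of a point\<close>

text \<open>
  Even a single element is dependent here: the coefficient $1$ gives a relation. So only the empty
  set is independent.
\<close>

lemma group_rank_trivial_group:
  fixes G (structure)
  assumes G: "trivial_group G"
  shows "group_rank G = 0"
proof -
  interpret group G using G by (simp add: trivial_group_def)
  have c: "carrier G = {\<one>}"
    using G by (simp add: trivial_group_def)
  interpret comm_group G
    by unfold_locales (use c in auto)
  have "B = {}" if "int_independent G B" for B
  proof (rule ccontr)
    assume "B \<noteq> {}"
    with that c have "B = {\<one>}"
      unfolding int_independent_def by auto
    then have "finprod G (\<lambda>b. b [^] (1 :: int)) B = \<one>"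
      by (intro finprod_one_eqI) (auto simp: int_pow_one)
    with that have "\<forall>b\<in>B. (1 :: int) = 0"
      unfolding int_independent_def by (elim conjE allE[of _ "\<lambda>_. 1"]) simp
    with \<open>B = {\<one>}\<close> show False by simp
  qed
  moreover have "int_independent G {}"
    by (simp add: int_independent_def)
  ultimately have "{B. int_independent G B} = {{}}" by blast
  then show ?thesis
    by (simp add: group_rank_def)
qed

text \<open>
  Any two integers satisfy a nontrivial linear relation, while a generator alone satisfies none.
\<close>

lemma group_rank_infinite_cyclic:
  fixes G (structure)
  assumes "group G" and iso: "G \<cong> integer_group"
  shows "group_rank G = 1"
proof -
  interpret group G by fact
  have iso': "integer_group \<cong> G" 
    using iso by (rule iso_sym)
  have "comm_group G"
    using abelian_integer_group comm_group.iso_imp_comm_group[OF _ iso'] is_monoid by blast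
  then interpret comm_group G .
  obtain f where f: "f \<in> iso G integer_group"
    using iso unfolding is_iso_def by blast
  have hom: "f \<in> hom G integer_group" and bij: "bij_betw f (carrier G) UNIV"
    using f by (auto simp: iso_def integer_group_def)
  interpret f: group_hom G integer_group f
    by (simp add: group_hom_def group_hom_axioms_def hom is_group)
  have f_mult: "f (a \<otimes> b) = f a + f b" if "a \<in> carrier G" "b \<in> carrier G" for a b
    using f.hom_mult[OF that] by simp
  have f_pow: "f (a [^] (n::int)) = n * f a" if "a \<in> carrier G" for a n
    using f.hom_int_pow[OF that] by simp
  have f_one: "f \<one> = 0"
    using f.hom_one by simp
  have inj: "a = b" if "f a = f b" "a \<in> carrier G" "b \<in> carrier G" for a b
    using bij that unfolding bij_betw_def inj_on_def by blast
  have le: "card B \<le> 1" if B: "int_independent G B" for B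
  proof (rule ccontr)
    assume "\<not> card B \<le> 1"
    then obtain a b where ab: "a \<in> B" "b \<in> B" "a \<noteq> b"
      using B by (metis One_nat_def card_le_Suc0_iff_eq int_independent_def)
    then have carr: "a \<in> carrier G" "b \<in> carrier G" "finite B" "B \<subseteq> carrier G"
      using B by (auto simp: int_independent_def)
    \<comment> \<open>the relation \<open>f b * a = f a * b\<close> between two integers\<close>
    define c where "c = (\<lambda>z. if z = a then f b else if z = b then - f a else 0)"
    have "finprod G (\<lambda>z. z [^] c z) B = finprod G (\<lambda>z. z [^] c z) {a, b}"
      using ab carr by (intro finprod_mono_neutral_cong_left[symmetric]) (auto simp: c_def)
    also have "\<dots> = a [^] f b \<otimes> b [^] (- f a)"
      using ab carr by (auto simp: c_def)
    also have "\<dots> = \<one>"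
      by (rule inj) (use carr in \<open>auto simp: f_mult f_pow f_one\<close>)
    finally have "\<forall>z\<in>B. c z = 0"
      using B by (auto simp: int_independent_def)
    then have "f b = 0" "f a = 0"
      using ab by (auto simp: c_def)
    then show False
      using inj[of a b] ab carr by simp
  qed
  obtain a where a: "a \<in> carrier G" "f a = 1"
    using bij by (metis UNIV_I bij_betw_iff_bijections)
  have "int_independent G {a}"
    unfolding int_independent_def
  proof (intro conjI allI impI ballI)
    fix c :: "_ \<Rightarrow> int" and b
    assume *: "finprod G (\<lambda>b. b [^] c b) {a} = \<one>" and "b \<in> {a}"
    then have "f (a [^] c a) = 0" using a f_one by simp
    then show "c b = 0" using a \<open>b \<in> {a}\<close> f_pow by simp
  qed (use a in auto)
  then have "1 \<in> card ` {B. int_independent G B}"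
    by (intro image_eqI[of _ _ "{a}"]) auto
  then show ?thesis
    unfolding group_rank_def using le by (intro cSup_eq_maximum) auto
qed

lemma euler_char_singleton:
  assumes "topspace X = {a}"
  shows "euler_char X = 1"
proof -
  have "path_connectedin X {a}"
    using assms by (simp only: path_connectedin_singleton) simp
  then have "path_connected_space X"
    using assms path_connectedin_topspace[of X] by metis
  then have "homology_group 0 X \<cong> integer_group"
    using assms by (intro isomorphic_integer_zeroth_homology_group) auto
  then have b0: "betti 0 X = 1"
    unfolding betti_def of_nat_0
    by (intro group_rank_infinite_cyclic group_relative_homology_group)
  have bp: "betti p X = 0" if "p \<noteq> 0" for p
    unfolding betti_def using that
    by (intro group_rank_trivial_group homology_dimension_axiom[OF assms]) simp
  have "betti p X \<noteq> 0 \<longleftrightarrow> p = 0" for p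
    using b0 bp by (cases "p = 0") auto
  then show ?thesis using b0 by (simp add: euler_char_def)
qed

section \<open>Diagonal lengths of Young diagrams\<close>

text \<open>
  Index the basis vectors at vertex \<open>i\<close> by the boxes of a diagram on the diagonal \<open>i\<close>, counted
  from the outermost row or column. Following an arrow towards the vertex $0$ keeps the position on
  the diagonal, and following an arrow away from $0$ lowers it by one; \<open>shift\<close> is this loss.
\<close>

fun shift :: "arrow \<Rightarrow> nat" where
  "shift (Down i) = (if i \<ge> 1 then 0 else 1)"
| "shift (Up i) = (if i \<ge> 1 then 1 else 0)"

text \<open>
  If a basis vector has position $b <$ \<open>v (src h)\<close> and $b \ge$ \<open>shift h\<close>, this inequality says that
  its shifted position is less than \<open>v (tgt h)\<close>. Along the arrows \<open>Down i\<close> and \<open>Up i\<close> together it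
  says that a diagonal is as long as its neighbour towards the main diagonal or shorter by one.
\<close>

definition admissible :: "gdim \<Rightarrow> bool" where
  "admissible v \<longleftrightarrow> (\<forall>h. v (src h) \<le> v (tgt h) + shift h)"

lemma admissible_iff:
  "admissible v \<longleftrightarrow>
     (\<forall>i\<ge>1. v i \<le> v (i - 1) \<and> v (i - 1) \<le> v i + 1) \<and>
     (\<forall>i\<le>0. v i \<le> v (i - 1) + 1 \<and> v (i - 1) \<le> v i)" (is "_ \<longleftrightarrow> ?R")
proof
  assume *: "admissible v"
  have "v (src (Down i)) \<le> v (tgt (Down i)) + shift (Down i)"
    "v (src (Up i)) \<le> v (tgt (Up i)) + shift (Up i)" for i
    using * unfolding admissible_def by blast+
  note * = this[simplified]
  show ?R
  proof (intro conjI allI impI)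
    fix i :: int
    show "1 \<le> i \<Longrightarrow> v i \<le> v (i - 1)" "1 \<le> i \<Longrightarrow> v (i - 1) \<le> v i + 1"
      "i \<le> 0 \<Longrightarrow> v i \<le> v (i - 1) + 1" "i \<le> 0 \<Longrightarrow> v (i - 1) \<le> v i"
      using *(1)[of i] *(2)[of i] by simp_all
  qed
next
  assume R: ?R
  show "admissible v"
    unfolding admissible_def
  proof
    fix h show "v (src h) \<le> v (tgt h) + shift h"
      using R by (cases h) auto
  qed
qed

lemma young_gdim_in_gdims: "young_gdim Y \<in> gdims"
proof -
  have "{r. young_gdim Y r \<noteq> 0} \<subseteq>
      (\<Union>i\<in>{1..length Y}. {1 - int i..int (Y ! (i - 1)) - int i})"
    by (auto simp: young_gdim_def card_gt_0_iff)
  then show ?thesis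
    unfolding gdims_def using finite_subset by blast
qed

text \<open>
  The set \<open>A r\<close> of the rows that meet the diagonal \<open>r\<close> is compared with \<open>A (r + 1)\<close> in two ways:
  by inclusion, and by moving to the previous row, which is at least as long. Either comparison loses
  at most one row.
\<close>

lemma young_gdim_admissible:
  assumes Y: "Y \<in> young_diagrams"
  shows "admissible (young_gdim Y)"
proof -
  define A where "A r = {i. 1 \<le> i \<and> i \<le> length Y \<and>
     1 - int i \<le> r \<and> r \<le> int (Y ! (i - 1)) - int i}" for r
  have fin: "finite (A r)" for r
    by (rule finite_subset[of _ "{..length Y}"]) (auto simp: A_def)
  have v: "young_gdim Y r = card (A r)" for r
    by (simp add: young_gdim_def A_def)
  have anti: "Y ! (i - 1) \<le> Y ! (i - 2)" if "2 \<le> i" "i \<le> length Y" for i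
    using Y that sorted_wrt_nth_less[of "(\<ge>)" Y "i - 2" "i - 1"]
    by (simp add: young_diagrams_def)
  have pred: "card (A r - {1}) \<le> card (A (r + 1))" for r
  proof (rule card_inj_on_le[where f = "\<lambda>i. i - 1"])
    show "(\<lambda>i. i - 1) ` (A r - {1}) \<subseteq> A (r + 1)"
    proof
      fix a assume "a \<in> (\<lambda>i. i - 1) ` (A r - {1})"
      then obtain i where i: "a = i - 1" "i \<in> A r" "i \<noteq> 1" by blast
      then have "2 \<le> i" "i \<le> length Y" by (auto simp: A_def)
      with anti[of i] i show "a \<in> A (r + 1)"
        by (auto simp: A_def of_nat_diff numeral_2_eq_2)
    qed
  qed (use fin in \<open>auto simp: inj_on_def A_def\<close>)
  have minus: "card (A r) \<le> card (A r - {a}) + 1" for r a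
    using card_Diff_singleton_if[of "A r" a] by simp linarith
  have "card (A i) \<le> card (A (i - 1))" if "i \<ge> 1" for i
    by (rule card_mono[OF fin]) (use that in \<open>auto simp: A_def\<close>)
  moreover have "card (A (i - 1)) \<le> card (A i) + 1" for i
    using pred[of "i - 1"] minus[of "i - 1" 1] by simp
  moreover have "card (A (i - 1)) \<le> card (A i)" if "i \<le> 0" for i
  proof -
    have "A (i - 1) - {1} = A (i - 1)" using that by (auto simp: A_def)
    then show ?thesis using pred[of "i - 1"] by simp
  qed
  moreover have "card (A i) \<le> card (A (i - 1)) + 1" if "i \<le> 0" for i
  proof -
    have "card (A i - {nat (1 - i)}) \<le> card (A (i - 1))"
      by (rule card_mono[OF fin]) (use that in \<open>auto simp: A_def\<close>)
    then show ?thesis using minus[of i "nat (1 - i)"] by linarith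
  qed
  ultimately show ?thesis
    unfolding admissible_iff v by blast
qed

lemma initial_segment_eq_atLeastAtMost_card:
  fixes A :: "nat set"
  assumes fin: "finite A" and pos: "0 \<notin> A" and down: "\<And>c. c \<ge> 1 \<Longrightarrow> Suc c \<in> A \<Longrightarrow> c \<in> A"
  shows "A = {1..card A}"
proof (cases "A = {}")
  case False
  have *: "a \<in> A" if "1 \<le> a" "a \<le> b" "b \<in> A" for a b
    using that(2)
  proof (induction rule: inc_induct)
    case (step n)
    then show ?case using that(1) down[of n] by simp
  qed (rule that(3))
  obtain m where m: "m \<in> A" "\<And>a. a \<in> A \<Longrightarrow> a \<le> m"
    using Max_in[OF fin False] Max_ge[OF fin] by blast
  have "A = {1..m}"
  proof (intro equalityI subsetI)
    fix a assume "a \<in> A"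
    then show "a \<in> {1..m}" using m pos by (cases a) auto
  next
    fix a assume "a \<in> {1..m}"
    then show "a \<in> A" using *[of a m] m(1) by simp
  qed
  then show ?thesis by simp
qed simp

text \<open>
  The box in row \<open>i\<close> and column \<open>c\<close> lies on the diagonal $c - i$, at position $\min(i,c)$. A diagram
  with diagonal lengths \<open>v\<close> must therefore consist of the boxes with $\min(i,c) \le v_{c-i}$, and
  the two inequalities of admissibility say that this set is closed under passing to the left and
  up.
\<close>

lemma admissible_eq_young_gdim:
  assumes adm: "admissible v" and fin: "v \<in> gdims"
  obtains Y where "Y \<in> young_diagrams" "young_gdim Y = v"
proof -
  have adm': "i \<ge> 1 \<Longrightarrow> v i \<le> v (i - 1)" "v (i - 1) \<le> v i + 1"
    "i \<le> 0 \<Longrightarrow> v (i - 1) \<le> v i" "v i \<le> v (i - 1) + 1" for i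
  proof -
    have "i \<ge> 1 \<longrightarrow> v i \<le> v (i - 1) \<and> v (i - 1) \<le> v i + 1"
      "i \<le> 0 \<longrightarrow> v i \<le> v (i - 1) + 1 \<and> v (i - 1) \<le> v i"
      using adm[unfolded admissible_iff] by blast+
    then show "i \<ge> 1 \<Longrightarrow> v i \<le> v (i - 1)" "v (i - 1) \<le> v i + 1"
      "i \<le> 0 \<Longrightarrow> v (i - 1) \<le> v i" "v i \<le> v (i - 1) + 1"
      by linarith+
  qed
  \<comment> \<open>the boxes of the diagram to be found\<close>
  define box where "box i c \<longleftrightarrow> i \<ge> 1 \<and> c \<ge> 1 \<and> min i c \<le> v (int c - int i)" for i c
  have left: "box i c" if "box i (Suc c)" "c \<ge> 1" for i c
  proof -
    define r where "r = int (Suc c) - int i"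
    have r: "r - 1 = int c - int i" by (simp add: r_def)
    have b: "i \<ge> 1" "min i (Suc c) \<le> v r"
      using that by (auto simp: box_def r_def)
    have "min i c \<le> v (r - 1)"
    proof (cases "c \<ge> i")
      case True
      then have "v r \<le> v (r - 1)" by (intro adm') (simp add: r_def)
      with True b show ?thesis by simp
    next
      case False
      with b adm'(4)[of r] show ?thesis by simp
    qed
    with b that(2) show ?thesis by (simp add: box_def r)
  qed
  have up: "box i c" if "box (Suc i) c" "i \<ge> 1" for i c
  proof -
    define r where "r = int c - int i"
    have r: "r - 1 = int c - int (Suc i)" by (simp add: r_def)
    have b: "c \<ge> 1" "min (Suc i) c \<le> v (r - 1)"
      using that by (auto simp: box_def r)
    have "min i c \<le> v r"
    proof (cases "c > i")
      case True
      with b adm'(2)[of r] show ?thesis by simp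
    next
      case False
      then have "v (r - 1) \<le> v r" by (intro adm') (simp add: r_def)
      with False b show ?thesis by simp
    qed
    with b that(2) show ?thesis by (simp add: box_def r_def)
  qed
  have supp: "finite {r. v r \<noteq> 0}"
    using fin by (simp add: gdims_def)
  have fin_row: "finite {c. box i c}" for i
  proof -
    have "{c. box i c} \<subseteq> (\<lambda>r. nat (r + int i)) ` {r. v r \<noteq> 0}"
    proof
      fix c assume "c \<in> {c. box i c}"
      then show "c \<in> (\<lambda>r. nat (r + int i)) ` {r. v r \<noteq> 0}"
        by (intro image_eqI[of _ _ "int c - int i"]) (auto simp: box_def)
    qed
    then show ?thesis using supp finite_surj by blast
  qed
  define L where "L i = card {c. box i c}" for i
  have row: "{c. box i c} = {1..L i}" for i
    unfolding L_def
  proof (rule initial_segment_eq_atLeastAtMost_card[OF fin_row])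
    show "0 \<notin> {c. box i c}" by (simp add: box_def)
  qed (use left in simp)
  have fin_col: "finite {i. box i 1}"
  proof -
    have "{i. box i 1} \<subseteq> (\<lambda>r. nat (1 - r)) ` {r. v r \<noteq> 0}"
    proof
      fix i assume "i \<in> {i. box i 1}"
      then show "i \<in> (\<lambda>r. nat (1 - r)) ` {r. v r \<noteq> 0}"
        by (intro image_eqI[of _ _ "1 - int i"]) (auto simp: box_def)
    qed
    then show ?thesis using supp finite_surj by blast
  qed
  define s where "s = card {i. box i 1}"
  have col: "{i. box i 1} = {1..s}"
    unfolding s_def
  proof (rule initial_segment_eq_atLeastAtMost_card[OF fin_col])
    show "0 \<notin> {i. box i 1}" by (simp add: box_def)
  qed (use up in simp)
  have box_L: "box i c \<longleftrightarrow> 1 \<le> c \<and> c \<le> L i" for i c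
    using eqset_imp_iff[OF row[of i], of c] by simp
  have box_s: "box i 1 \<longleftrightarrow> 1 \<le> i \<and> i \<le> s" for i
    using eqset_imp_iff[OF col, of i] by simp
  define Y where "Y = map L [1..<Suc s]"
  have len: "length Y = s" and nth: "1 \<le> i \<Longrightarrow> i \<le> s \<Longrightarrow> Y ! (i - 1) = L i" for i
    by (auto simp: Y_def nth_append simp del: upt_Suc)
  have L_Suc: "L (Suc i) \<le> L i" if "i \<ge> 1" for i
    unfolding L_def by (rule card_mono[OF fin_row]) (use up[OF _ that] in blast)
  have L_anti: "L b \<le> L a" if "1 \<le> a" "a \<le> b" for a b
    using that(2)
  proof (induction rule: dec_induct)
    case (step b)
    then show ?case using L_Suc[of b] that(1) by linarith
  qed simp
  have sorted: "sorted_wrt (\<ge>) Y"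
    by (auto simp: sorted_wrt_iff_nth_less Y_def L_anti simp del: upt_Suc)
  have "L i > 0" if "1 \<le> i" "i \<le> s" for i
    using box_s[of i] box_L[of i 1] that by simp
  then have pos: "\<forall>l\<in>set Y. l > 0"
    by (auto simp: Y_def simp del: upt_Suc)
  have v: "young_gdim Y r = v r" for r
  proof -
    have "{i. 1 \<le> i \<and> i \<le> length Y \<and> 1 - int i \<le> r \<and> r \<le> int (Y ! (i - 1)) - int i} =
        {i. box i (nat (r + int i))}" (is "?A = ?B")
    proof (intro equalityI subsetI)
      fix i assume "i \<in> ?A"
      then show "i \<in> ?B"
        using nth[of i] len box_L[of i "nat (r + int i)"] by (simp; arith)
    next
      fix i assume "i \<in> ?B"
      then have b: "box i (nat (r + int i))" by simp
      then have "1 \<le> nat (r + int i)" "nat (r + int i) \<le> L i"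
        using box_L[of i "nat (r + int i)"] by auto
      moreover from this have "box i 1" using box_L[of i 1] by simp
      then have "1 \<le> i" "i \<le> s" using box_s by auto
      ultimately show "i \<in> ?A"
        using nth[of i] len by (simp; arith)
    qed
    also have "\<dots> = (if r \<ge> 0 then {1..v r} else {nat (1 - r)..nat (int (v r) - r)})"
    proof (cases "r \<ge> 0")
      case True
      then have "i \<le> nat (r + int i)" for i by simp
      then have "box i (nat (r + int i)) \<longleftrightarrow> i \<in> {1..v r}" for i
        unfolding box_def using True by (simp add: min_absorb1; arith)
      then show ?thesis unfolding if_P[OF True] by blast
    next
      case False
      define n where "n = v r"
      have "box i (nat (r + int i)) \<longleftrightarrow> i \<ge> 1 \<and> nat (r + int i) \<ge> 1 \<and> nat (r + int i) \<le> n" for i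
      proof (cases "r + int i \<ge> 1")
        case True
        then have "min i (nat (r + int i)) = nat (r + int i)" "int (nat (r + int i)) - int i = r"
          using False by simp_all
        then show ?thesis by (simp add: box_def n_def)
      qed (simp add: box_def)
      also have "\<dots> i \<longleftrightarrow> nat (1 - r) \<le> i \<and> i \<le> nat (int n - r)" for i
        using False by arith
      finally have "box i (nat (r + int i)) \<longleftrightarrow> i \<in> {nat (1 - r)..nat (int (v r) - r)}" for i
        by (simp add: n_def)
      then show ?thesis unfolding if_not_P[OF False] by blast
    qed
    also have "card \<dots> = v r"
    proof (cases "r \<ge> 0")
      case False
      then have "Suc (nat (int n - r)) - nat (1 - r) = n" for n by arith
      with False show ?thesis by simp
    qed simp
    finally show ?thesis by (simp add: young_gdim_def)
  qed
  show ?thesis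
  proof (rule that)
    show "young_gdim Y = v" using v by blast
    show "Y \<in> young_diagrams" using sorted pos by (simp add: young_diagrams_def)
  qed
qed

section \<open>Matrices and subspaces of coordinate spaces\<close>

lemma wide_mat_kernel_nontrivial:
  fixes A :: "'a :: field mat"
  assumes A: "A \<in> carrier_mat nr nc" and less: "nr < nc"
  obtains z where "z \<in> carrier_vec nc" "z \<noteq> 0\<^sub>v nc" "A *\<^sub>v z = 0\<^sub>v nr"
proof -
  \<comment> \<open>pad with zero rows to a square matrix\<close>
  define B where "B = mat nc nc (\<lambda>(i, j). if i < nr then A $$ (i, j) else 0)"
  have B: "B \<in> carrier_mat nc nc" by (simp add: B_def)
  have "B = mat\<^sub>r nc nc (\<lambda>i. if i = nr then 0\<^sub>v nc else row B i)"
    using less by (intro eq_matI) (auto simp: B_def)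
  also have "det \<dots> = 0"
    by (rule det_row_0[OF less]) (simp add: B_def)
  finally obtain z where z: "z \<in> carrier_vec nc" "z \<noteq> 0\<^sub>v nc" "B *\<^sub>v z = 0\<^sub>v nc"
    using det_0_iff_vec_prod_zero_field[OF B] by blast
  have "A *\<^sub>v z = 0\<^sub>v nr"
  proof (rule eq_vecI)
    fix i assume "i < dim_vec (0\<^sub>v nr)"
    then have i: "i < nr" "i < nc" using less by auto
    then have "row A i = row B i"
      using A by (intro eq_vecI) (auto simp: B_def)
    then have "(A *\<^sub>v z) $ i = (B *\<^sub>v z) $ i"
      using i A B by simp
    then show "(A *\<^sub>v z) $ i = 0\<^sub>v nr $ i" using z i by simp
  qed (use A in simp)
  with z that show ?thesis by blast
qed

lemma trivial_kernel_imp_Units_ring_mat: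
  fixes A :: "'a :: field mat"
  assumes A: "A \<in> carrier_mat n n"
    and ker: "\<And>z. z \<in> carrier_vec n \<Longrightarrow> A *\<^sub>v z = 0\<^sub>v n \<Longrightarrow> z = 0\<^sub>v n"
  shows "A \<in> Units (ring_mat TYPE('a) n b)"
proof (rule det_non_zero_imp_unit[OF A])
  show "det A \<noteq> 0"
    unfolding det_0_iff_vec_prod_zero_field[OF A] using ker by blast
qed

lemma Units_ring_mat_inv:
  fixes A :: "'a :: field mat"
  assumes "A \<in> Units (ring_mat TYPE('a) n b)"
  defines "B \<equiv> inv\<^bsub>ring_mat TYPE('a) n b\<^esub> A"
  shows "A \<in> carrier_mat n n" "B \<in> carrier_mat n n" "A * B = 1\<^sub>m n" "B * A = 1\<^sub>m n"
    "B \<in> Units (ring_mat TYPE('a) n b)"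
proof -
  interpret ring "ring_mat TYPE('a) n b" by (rule ring_mat)
  show "A \<in> carrier_mat n n" "B \<in> carrier_mat n n" "A * B = 1\<^sub>m n" "B * A = 1\<^sub>m n"
    "B \<in> Units (ring_mat TYPE('a) n b)"
    using Units_closed[OF assms(1)] Units_inv_closed[OF assms(1)] Units_r_inv[OF assms(1)]
      Units_l_inv[OF assms(1)] Units_inv_Units[OF assms(1)]
    by (simp_all add: ring_mat_simps B_def)
qed

lemma Units_ring_matI:
  fixes A :: "'a :: field mat"
  assumes "A \<in> carrier_mat n n" "B \<in> carrier_mat n n" "A * B = 1\<^sub>m n" "B * A = 1\<^sub>m n"
  shows "A \<in> Units (ring_mat TYPE('a) n b)"
  using assms by (auto simp: Units_def ring_mat_simps)

lemma subspace_module_vec_iff: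
  fixes W :: "'a :: field vec set"
  shows "VectorSpace.subspace class_ring W (module_vec TYPE('a) n) \<longleftrightarrow>
    W \<subseteq> carrier_vec n \<and> 0\<^sub>v n \<in> W \<and> (\<forall>a\<in>W. \<forall>b\<in>W. a + b \<in> W) \<and> (\<forall>c. \<forall>a\<in>W. c \<cdot>\<^sub>v a \<in> W)"
  using vec_vs[of n, where ?'a = 'a] vec_module[of n, where ?'a = 'a]
  by (simp add: VectorSpace.subspace_def LinearCombinations.submodule_def module_vec_simps class_ring_simps) blast

text \<open>
  A maximal independent subset of the subspace is a basis of it. With \<open>n\<close> elements, it is also a
  basis of the whole space.
\<close>

lemma subspace_eq_carrier_vec:
  fixes W :: "'a :: field vec set"
  assumes W: "VectorSpace.subspace class_ring W (module_vec TYPE('a) n)"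
    and dim: "vectorspace.dim class_ring ((module_vec TYPE('a) n)\<lparr>carrier := W\<rparr>) = n"
  shows "W = carrier_vec n"
proof -
  interpret V: vec_space "TYPE('a)" n .
  have sub: "W \<subseteq> carrier_vec n"
    using W by (simp add: subspace_module_vec_iff)
  have submod: "LinearCombinations.submodule class_ring W V.V"
    using W by (simp add: VectorSpace.subspace_def)
  interpret W: vectorspace class_ring "V.vs W"
    by (rule V.subspace_is_vs[OF W])
  have li_iff: "W.lin_dep B \<longleftrightarrow> V.lin_dep B" if "B \<subseteq> W" for B
    using V.span_li_not_depend(2)[OF that submod] .
  have small: "finite B \<and> card B \<le> n" if "B \<subseteq> carrier (V.vs W) \<and> W.lin_indpt B" for B
  proof -
    have "B \<subseteq> W" "V.lin_indpt B" using that li_iff[of B] by simp_all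
    then show ?thesis
      using sub V.li_le_dim[OF V.fin_dim, of B] V.dim_is_n by simp
  qed
  have "\<exists>B. finite B \<and> maximal B (\<lambda>B. B \<subseteq> carrier (V.vs W) \<and> W.lin_indpt B)"
  proof (rule maximal_exists[where N = n and B = "{}"])
    show "{} \<subseteq> carrier (V.vs W) \<and> W.lin_indpt {}"
      unfolding W.lin_dep_def by blast
  qed (rule small)
  then obtain B where fin: "finite B" and max: "maximal B (\<lambda>B. B \<subseteq> carrier (V.vs W) \<and> W.lin_indpt B)"
    by blast
  have basis: "W.basis B" by (rule W.max_li_is_basis[OF max])
  then have B: "B \<subseteq> W" "W.lin_indpt B" "W.span B = W"
    by (simp_all add: W.basis_def)
  have "card B = n" using W.dim_basis[OF fin basis] dim by simp
  then have "V.basis B"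
    using B sub li_iff[of B] fin V.dim_is_n V.fin_dim by (intro V.dim_li_is_basis) simp_all
  then have "V.span B = carrier_vec n" by (simp add: V.basis_def)
  moreover have "V.span B = W.span B"
    using V.span_li_not_depend(1)[OF B(1) submod] by simp
  ultimately show ?thesis using B(3) by simp
qed

lemma
  fixes A :: "'a :: field mat"
  assumes A: "A \<in> carrier_mat n m" and inj: "inj_on (\<lambda>s. A *\<^sub>v s) (carrier_vec m)"
  defines "W \<equiv> (\<lambda>s. A *\<^sub>v s) ` carrier_vec m"
  shows subspace_range_mat: "VectorSpace.subspace class_ring W (module_vec TYPE('a) n)"
    and dim_range_inj_mat: "vectorspace.dim class_ring ((module_vec TYPE('a) n)\<lparr>carrier := W\<rparr>) = m"
proof -
  interpret M: vec_space "TYPE('a)" m .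
  interpret V: vec_space "TYPE('a)" n .
  show sub: "VectorSpace.subspace class_ring W (module_vec TYPE('a) n)"
    unfolding subspace_module_vec_iff
  proof (intro conjI ballI allI)
    show "0\<^sub>v n \<in> W"
      unfolding W_def using A by (intro image_eqI[of _ _ "0\<^sub>v m"]) auto
    fix a assume "a \<in> W"
    then obtain a' where a: "a = A *\<^sub>v a'" "a' \<in> carrier_vec m" by (auto simp: W_def)
    show "c \<cdot>\<^sub>v a \<in> W" for c
      unfolding W_def using A a
      by (intro image_eqI[of _ _ "c \<cdot>\<^sub>v a'"]) (auto simp: mult_mat_vec)
    fix b assume "b \<in> W"
    then obtain b' where b: "b = A *\<^sub>v b'" "b' \<in> carrier_vec m" by (auto simp: W_def)
    show "a + b \<in> W"
      unfolding W_def using A a b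
      by (intro image_eqI[of _ _ "a' + b'"]) (auto simp: mult_add_distrib_mat_vec)
  qed (use A in \<open>auto simp: W_def\<close>)
  interpret W: vectorspace class_ring "V.vs W"
    by (rule V.subspace_is_vs[OF sub])
  interpret T: linear_map class_ring M.V "V.vs W" "\<lambda>s. A *\<^sub>v s"
    apply unfold_locales
    using A by (auto simp: module_hom_def W_def mult_mat_vec mult_add_distrib_mat_vec module_vec_simps)
  have "M.dim = W.dim"
    by (rule T.dim_eq) (use M.fin_dim inj in \<open>simp_all add: W_def\<close>)
  then show "vectorspace.dim class_ring ((module_vec TYPE('a) n)\<lparr>carrier := W\<rparr>) = m"
    using M.dim_is_n by simp
qed

lemma mult_mat_vec_index_sum:
  assumes "A \<in> carrier_mat n m" "z \<in> carrier_vec m" "a < n"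
  shows "(A *\<^sub>v z) $ a = (\<Sum>l<m. A $$ (a, l) * z $ l)"
  using assms by (simp add: scalar_prod_def atLeast0LessThan)

lemma pow_mat_add:
  assumes "A \<in> carrier_mat n n"
  shows "A ^\<^sub>m (k + m) = A ^\<^sub>m k * A ^\<^sub>m m"
  using assms
proof (induction m)
  case (Suc m)
  then show ?case
    using assoc_mult_mat[OF pow_carrier_mat[OF assms] pow_carrier_mat[OF assms] assms, of k m] by simp
qed simp

lemma cancel_right_inverse:
  fixes A :: "complex mat"
  assumes "A \<in> carrier_mat m n" "g \<in> carrier_mat n n" "g' \<in> carrier_mat n n" "g * g' = 1\<^sub>m n"
  shows "A * g * g' = A"
  using assoc_mult_mat[OF assms(1-3)] assms by simp

lemma cancel_left_inverse:
  fixes A :: "complex mat"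
  assumes "A \<in> carrier_mat n m" "g \<in> carrier_mat k n" "g' \<in> carrier_mat n k" "g' * g = 1\<^sub>m n"
  shows "g' * (g * A) = A"
  using assoc_mult_mat[OF assms(3,2,1)] assms by simp

text \<open>
  For $m \le n$ this is the inclusion of the span of the first $m$ basis vectors into
  $\mathbf C^n$, and for $m \ge n$ it is the projection onto the first $n$ coordinates.
\<close>

definition rect_id :: "nat \<Rightarrow> nat \<Rightarrow> complex mat" where
  "rect_id n m = mat n m (\<lambda>(a, b). if a = b then 1 else 0)"

lemma rect_id_carrier [simp]: "rect_id n m \<in> carrier_mat n m"
  by (simp add: rect_id_def)

lemma rect_id_mult_vec:
  assumes "s \<in> carrier_vec m" "a < n"
  shows "(rect_id n m *\<^sub>v s) $ a = (if a < m then s $ a else 0)"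
proof -
  have "(rect_id n m *\<^sub>v s) $ a = (\<Sum>b<m. rect_id n m $$ (a, b) * s $ b)"
    by (rule mult_mat_vec_index_sum[OF _ assms]) simp
  also have "\<dots> = (\<Sum>b<m. if b = a then s $ b else 0)"
    using assms by (intro sum.cong) (auto simp: rect_id_def)
  finally show ?thesis by simp
qed

lemma rect_id_mult_mat:
  assumes "B \<in> carrier_mat m l" "a < n" "b < l"
  shows "(rect_id n m * B) $$ (a, b) = (if a < m then B $$ (a, b) else 0)"
proof -
  have "(rect_id n m * B) $$ (a, b) = (rect_id n m *\<^sub>v col B b) $ a"
    using assms by (simp add: rect_id_def)
  also have "\<dots> = (if a < m then col B b $ a else 0)"
    by (rule rect_id_mult_vec) (use assms in auto)
  finally show ?thesis using assms by auto
qed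

lemma rect_id_left_inverse:
  assumes "m \<le> n" "B \<in> carrier_mat m l"
  shows "rect_id m n * (rect_id n m * B) = B"
proof (rule eq_matI)
  have C: "rect_id n m * B \<in> carrier_mat n l" using assms by (intro mult_carrier_mat) auto
  fix a b assume "a < dim_row B" "b < dim_col B"
  then have ab: "a < m" "b < l" using assms by auto
  have "(rect_id m n * (rect_id n m * B)) $$ (a, b) = (rect_id n m * B) $$ (a, b)"
    using rect_id_mult_mat[OF C ab] ab assms(1) by (simp only: if_True order.strict_trans2)
  also have "\<dots> = B $$ (a, b)"
    using rect_id_mult_mat[OF assms(2) order.strict_trans2[OF ab(1) assms(1)] ab(2)] ab(1)
    by (simp only: if_True)
  finally show "(rect_id m n * (rect_id n m * B)) $$ (a, b) = B $$ (a, b)" .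
qed (use carrier_matD[OF assms(2)] in \<open>simp_all add: rect_id_def\<close>)

lemma rect_id_cancel:
  assumes "m \<le> n" "B \<in> carrier_mat m l" "C \<in> carrier_mat m l" "rect_id n m * B = rect_id n m * C"
  shows "B = C"
  using rect_id_left_inverse[OF assms(1,2)] rect_id_left_inverse[OF assms(1,3)] assms(4) by metis

lemma range_rect_id:
  assumes "m \<le> n"
  shows "(\<lambda>s. rect_id n m *\<^sub>v s) ` carrier_vec m =
    {s \<in> carrier_vec n. \<forall>a. m \<le> a \<and> a < n \<longrightarrow> s $ a = 0}" (is "?L = ?R")
proof (intro equalityI subsetI)
  fix s assume "s \<in> ?L"
  then obtain t where t: "t \<in> carrier_vec m" "s = rect_id n m *\<^sub>v t" by blast
  then have "s \<in> carrier_vec n" using mult_mat_vec_carrier[OF rect_id_carrier t(1), of n] by simp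
  then show "s \<in> ?R" using rect_id_mult_vec[OF t(1), of _ n] t(2) by simp
next
  fix s assume s: "s \<in> ?R"
  define t where "t = vec m (\<lambda>a. s $ a)"
  have t: "t \<in> carrier_vec m" by (simp add: t_def)
  have "s = rect_id n m *\<^sub>v t"
  proof (rule eq_vecI)
    fix a assume "a < dim_vec (rect_id n m *\<^sub>v t)"
    then have a: "a < n" by (simp add: rect_id_def)
    then show "s $ a = (rect_id n m *\<^sub>v t) $ a"
      using rect_id_mult_vec[OF t a] s by (simp add: t_def)
  qed (use s in \<open>simp add: rect_id_def\<close>)
  with t show "s \<in> ?L" by blast
qed

lemma inj_on_rect_id:
  assumes "m \<le> n"
  shows "inj_on (\<lambda>s. rect_id n m *\<^sub>v s) (carrier_vec m)"
proof (rule inj_onI)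
  fix s t assume s: "s \<in> carrier_vec m" and t: "t \<in> carrier_vec m"
    and eq: "rect_id n m *\<^sub>v s = rect_id n m *\<^sub>v t"
  show "s = t"
  proof (rule eq_vecI)
    fix a assume "a < dim_vec t"
    then have a: "a < m" "a < n" using t assms by auto
    then show "s $ a = t $ a"
      using rect_id_mult_vec[OF s a(2)] rect_id_mult_vec[OF t a(2)] eq by simp
  qed (use s t in simp)
qed

section \<open>The canonical stable point\<close>

text \<open>
  The dual of the quotient of $\mathbf C[a,b]$ by a monomial ideal, in the basis dual to the
  monomials: an arrow is dual to the multiplication by $a$ or $b$, so it lowers an exponent and
  kills the vectors that have exponent $0$.
\<close>

definition can_rep :: "gdim \<Rightarrow> qrep" where
  "can_rep v = (\<lambda>h. mat (v (tgt h)) (v (src h)) (\<lambda>(a, b). if b = a + shift h then 1 else 0))"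

definition can_framing :: "gdim \<Rightarrow> gmap" where
  "can_framing v = (\<lambda>i. mat (w0 i) (v i) (\<lambda>(a, b). if b = 0 then 1 else 0))"

lemma opp_simps [simp]: "tgt (opp h) = src h" "src (opp h) = tgt h" "opp (opp h) = h"
  by (cases h; simp)+

lemma shift_opp: "shift h + shift (opp h) = 1"
  by (cases h) auto

lemma arrows_into: "{h. tgt h = i} = {Down (i + 1), Up i}"
proof -
  have "tgt h = i \<longleftrightarrow> h \<in> {Down (i + 1), Up i}" for h by (cases h) auto
  then show ?thesis by blast
qed

lemma rep_spaceD: "x \<in> rep_space v \<Longrightarrow> x h \<in> carrier_mat (v (tgt h)) (v (src h))"
  by (simp add: rep_space_def)

text \<open>
  The two arrows into \<open>i\<close> have opposite signs, so the moment map is the difference of the loops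
  through $i+1$ and through $i-1$.
\<close>

lemma moment_eq_zero_iff:
  assumes x: "x \<in> rep_space v"
  shows "moment v x i = 0\<^sub>m (v i) (v i) \<longleftrightarrow>
    x (Down (i + 1)) * x (Up (i + 1)) = x (Up i) * x (Down i)"
proof -
  have carr: "x (Down (i + 1)) * x (Up (i + 1)) \<in> carrier_mat (v i) (v i)"
    "x (Up i) * x (Down i) \<in> carrier_mat (v i) (v i)"
    using rep_spaceD[OF x, of "Down (i + 1)"] rep_spaceD[OF x, of "Up (i + 1)"]
      rep_spaceD[OF x, of "Down i"] rep_spaceD[OF x, of "Up i"] by auto
  define A where "A = x (Down (i + 1)) * x (Up (i + 1))"
  define B where "B = x (Up i) * x (Down i)"
  note carr = carr[folded A_def B_def]
  have "moment v x i = mat (v i) (v i) (\<lambda>ab. A $$ ab - B $$ ab)"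
    unfolding moment_def arrows_into A_def B_def by simp
  also have "\<dots> = A - B"
    using carr by (intro eq_matI) auto
  also have "A - B = 0\<^sub>m (v i) (v i) \<longleftrightarrow> A = B"
  proof
    assume *: "A - B = 0\<^sub>m (v i) (v i)"
    show "A = B"
    proof (rule eq_matI)
      fix a b assume ab: "a < dim_row B" "b < dim_col B"
      then have "(A - B) $$ (a, b) = 0" using * carr by simp
      then show "A $$ (a, b) = B $$ (a, b)" using ab by simp
    qed (use carr in auto)
  next
    assume "A = B"
    then show "A - B = 0\<^sub>m (v i) (v i)" using carr by simp
  qed
  finally show ?thesis by (simp add: A_def B_def)
qed

lemma can_rep_in_rep_space: "can_rep v \<in> rep_space v"
  by (simp add: rep_space_def can_rep_def)

lemma can_rep_carrier: "can_rep v h \<in> carrier_mat (v (tgt h)) (v (src h))"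
  by (simp add: can_rep_def)

lemma can_framing_in_gmaps: "can_framing v \<in> gmaps v w0"
  by (simp add: gmaps_def can_framing_def)

lemma can_rep_mult_vec:
  assumes "s \<in> carrier_vec (v (src h))" "a < v (tgt h)"
  shows "(can_rep v h *\<^sub>v s) $ a = (if a + shift h < v (src h) then s $ (a + shift h) else 0)"
proof -
  have "(can_rep v h *\<^sub>v s) $ a = (\<Sum>b<v (src h). (if b = a + shift h then 1 else 0) * s $ b)"
    using assms by (simp add: can_rep_def scalar_prod_def atLeast0LessThan)
  also have "\<dots> = (\<Sum>b<v (src h). if b = a + shift h then s $ b else 0)"
    by (rule sum.cong) auto
  finally show ?thesis by simp
qed

lemma can_framing_mult_vec:
  assumes "s \<in> carrier_vec (v 0)" "0 < v 0"
  shows "(can_framing v 0 *\<^sub>v s) $ 0 = s $ 0"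
proof -
  have "(can_framing v 0 *\<^sub>v s) $ 0 = (\<Sum>b<v 0. (if b = 0 then 1 else 0) * s $ b)"
    using assms by (simp add: can_framing_def w0_def scalar_prod_def atLeast0LessThan)
  also have "\<dots> = (\<Sum>b<v 0. if b = 0 then s $ b else 0)"
    by (rule sum.cong) simp_all
  finally show ?thesis using assms by simp
qed

lemma can_rep_mult_mat:
  assumes "A \<in> carrier_mat (v (src h)) n" "a < v (tgt h)" "b < n"
  shows "(can_rep v h * A) $$ (a, b) =
    (if a + shift h < v (src h) then A $$ (a + shift h, b) else 0)"
proof -
  have "(can_rep v h * A) $$ (a, b) = (can_rep v h *\<^sub>v col A b) $ a"
    using assms by (simp add: can_rep_def)
  also have "\<dots> = (if a + shift h < v (src h) then col A b $ (a + shift h) else 0)"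
    by (rule can_rep_mult_vec) (use assms in auto)
  finally show ?thesis using assms by auto
qed

text \<open>
  The shifts of an arrow and of its opposite add up to one, so the loops at a vertex through either
  neighbour are the same nilpotent Jordan block. Admissibility keeps the intermediate vector from
  being cut off.
\<close>

lemma can_rep_opp:
  assumes "admissible v"
  shows "can_rep v h * can_rep v (opp h) =
    mat (v (tgt h)) (v (tgt h)) (\<lambda>(a, b). if b = a + 1 then 1 else 0)"
proof (rule eq_matI)
  fix a b
  assume "a < dim_row (mat (v (tgt h)) (v (tgt h)) (\<lambda>(a, b). if b = a + 1 then 1 else 0))"
    "b < dim_col (mat (v (tgt h)) (v (tgt h)) (\<lambda>(a, b). if b = a + 1 then 1 else 0))"
  then have ab: "a < v (tgt h)" "b < v (tgt h)" by auto
  have le: "v (tgt h) \<le> v (src h) + shift (opp h)"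
    using assms unfolding admissible_def by (metis opp_simps(1,2))
  have s: "a + 1 = a + shift h + shift (opp h)" using shift_opp[of h] by simp
  have "(can_rep v h * can_rep v (opp h)) $$ (a, b) =
      (if a + shift h < v (src h) then can_rep v (opp h) $$ (a + shift h, b) else 0)"
    by (rule can_rep_mult_mat) (use ab in \<open>auto simp: can_rep_def\<close>)
  also have "\<dots> = (if b = a + 1 then 1 else 0)"
    using ab le s by (auto simp: can_rep_def)
  finally show "(can_rep v h * can_rep v (opp h)) $$ (a, b) =
      mat (v (tgt h)) (v (tgt h)) (\<lambda>(a, b). if b = a + 1 then 1 else 0) $$ (a, b)"
    using ab by simp
qed (auto simp: can_rep_def)

text \<open>
  The number of arrows on a path that leads from this basis vector to the framed basis vector, the
  one with $i = 0$ and $b = 0$. Every arrow lowers it by one, which gives both the nilpotency and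
  the stability of the canonical point.
\<close>

definition height :: "int \<Rightarrow> nat \<Rightarrow> nat" where
  "height i b = 2 * b + nat \<bar>i\<bar>"

lemma height_arrow: "height (src h) (a + shift h) = height (tgt h) a + 1"
  by (cases h) (auto simp: height_def)

lemma path_map_can_rep:
  assumes "hs \<noteq> []" "successively (\<lambda>h h'. tgt h = src h') hs"
  shows "path_map (can_rep v) hs \<in> carrier_mat (v (tgt (last hs))) (v (src (hd hs))) \<and>
    (\<forall>a<v (tgt (last hs)). \<forall>b<v (src (hd hs)). path_map (can_rep v) hs $$ (a, b) \<noteq> 0 \<longrightarrow>
      height (src (hd hs)) b = height (tgt (last hs)) a + length hs)"
  using assms
proof (induction hs rule: induct_list012)
  case (2 h)
  show ?case using height_arrow[of h] by (auto simp: can_rep_def)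
next
  case (3 h h' hs)
  let ?P = "path_map (can_rep v) (h' # hs)"
  let ?t = "tgt (last (h' # hs))"
  have eq: "src h' = tgt h" "successively (\<lambda>h h'. tgt h = src h') (h' # hs)"
    using 3 by auto
  then have IH: "?P \<in> carrier_mat (v ?t) (v (tgt h))"
    "\<And>a c. a < v ?t \<Longrightarrow> c < v (tgt h) \<Longrightarrow> ?P $$ (a, c) \<noteq> 0 \<Longrightarrow>
      height (tgt h) c = height ?t a + length (h' # hs)"
    using 3 by auto
  have h: "can_rep v h \<in> carrier_mat (v (tgt h)) (v (src h))"
    by (simp add: can_rep_def)
  have "height (src h) b = height ?t a + length (h # h' # hs)"
    if ab: "a < v ?t" "b < v (src h)" and nz: "(?P * can_rep v h) $$ (a, b) \<noteq> 0" for a b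
  proof -
    have "(?P * can_rep v h) $$ (a, b) =
        (\<Sum>c<v (tgt h). ?P $$ (a, c) * can_rep v h $$ (c, b))"
      using ab IH(1) h by (simp add: scalar_prod_def atLeast0LessThan)
    with nz obtain c where c: "c < v (tgt h)" "?P $$ (a, c) * can_rep v h $$ (c, b) \<noteq> 0"
      by (metis (no_types, lifting) lessThan_iff sum.neutral)
    then have "b = c + shift h"
      using ab by (simp add: can_rep_def split: if_splits)
    then have "height (src h) b = height (tgt h) c + 1"
      using height_arrow by simp
    also have "height (tgt h) c = height ?t a + length (h' # hs)"
      using IH(2)[of a c] c ab by simp
    finally show ?thesis by simp
  qed
  moreover have "?P * can_rep v h \<in> carrier_mat (v ?t) (v (src h))"
    using IH(1) h by simp
  ultimately show ?case by simp
qed simp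

lemma nilpotent_can_rep:
  assumes "v \<in> gdims"
  shows "nilpotent_rep v (can_rep v)"
proof -
  have "finite (\<Union>i\<in>{i. v i \<noteq> 0}. (\<lambda>b. height i b) ` {..<v i})"
    using assms by (auto simp: gdims_def)
  then obtain N where N: "\<forall>n\<in>(\<Union>i\<in>{i. v i \<noteq> 0}. (\<lambda>b. height i b) ` {..<v i}). n < N"
    using finite_nat_set_iff_bounded by blast
  show ?thesis
    unfolding nilpotent_rep_def
  proof (intro exI allI impI)
    fix hs
    assume hs: "hs \<noteq> [] \<and> N \<le> length hs \<and> successively (\<lambda>h h'. tgt h = src h') hs"
    let ?t = "tgt (last hs)" and ?s = "src (hd hs)"
    note P = path_map_can_rep[OF hs[THEN conjunct1] hs[THEN conjunct2, THEN conjunct2], of v]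
    have "path_map (can_rep v) hs $$ (a, b) = 0" if "a < v ?t" "b < v ?s" for a b
    proof -
      have "height ?s b < N" using N that by auto
      then have "height ?s b \<noteq> height ?t a + length hs" using hs by linarith
      then show ?thesis using P that by blast
    qed
    then show "path_map (can_rep v) hs = 0\<^sub>m (v ?t) (v ?s)"
      using P by (intro eq_matI) auto
  qed
qed

text \<open>
  For stability, the coordinates of a vector in a stable subspace killed by \<open>j\<close> vanish by induction
  on the height: some arrow moves a given coordinate, unless it is the framed one, to a coordinate
  of smaller height of another vector of the subspace, and the framed coordinate is the value
  of \<open>j\<close>.
\<close>

lemma can_rep_in_Lambda_st:
  assumes adm: "admissible v" and fin: "v \<in> gdims"
  shows "(can_rep v, can_framing v) \<in> Lambda_st v w0"
proof -
  have "can_rep v (Down (i + 1)) * can_rep v (Up (i + 1)) = can_rep v (Up i) * can_rep v (Down i)" for i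
    using can_rep_opp[OF adm, of "Down (i + 1)"] can_rep_opp[OF adm, of "Up i"] by simp
  then have "moment v (can_rep v) i = 0\<^sub>m (v i) (v i)" for i
    using moment_eq_zero_iff[OF can_rep_in_rep_space] by blast
  then have "(can_rep v, can_framing v) \<in> Lambda v w0"
    using can_rep_in_rep_space can_framing_in_gmaps nilpotent_can_rep[OF fin]
    by (simp add: Lambda_def Lambda_V_def)
  moreover have zero_S: "S i = {0\<^sub>v (v i)}"
    if S: "graded_subspace v S" "rep_stable (can_rep v) S"
      and ker: "\<forall>i. \<forall>s\<in>S i. can_framing v i *\<^sub>v s = 0\<^sub>v (w0 i)" for S i
  proof -
    have sub: "S i \<subseteq> carrier_vec (v i)" "0\<^sub>v (v i) \<in> S i" for i
      using S(1) by (auto simp: graded_subspace_def subspace_module_vec_iff)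
    have zero: "s $ b = 0" if "s \<in> S i" "b < v i" for i b and s :: "complex Matrix.vec"
      using that
    proof (induction "height i b" arbitrary: i b s rule: less_induct)
      case less
      have s: "s \<in> carrier_vec (v i)" using less.prems sub by blast
      show ?case
      proof (cases "i = 0 \<and> b = 0")
        case True
        then have "(can_framing v 0 *\<^sub>v s) $ 0 = s $ 0"
          using can_framing_mult_vec[of s v] s less.prems by simp
        moreover have "can_framing v 0 *\<^sub>v s = 0\<^sub>v (w0 0)"
          using ker less.prems True by blast
        ultimately show ?thesis using True by (simp add: w0_def)
      next
        case False
        obtain h where h: "src h = i" "shift h \<le> b"
        proof (cases "i \<ge> 1")
          case True
          then show ?thesis by (intro that[of "Down i"]) auto
        next
          case not_pos: False
          show ?thesis
          proof (cases "i < 0")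
            case True
            then show ?thesis by (intro that[of "Up (i + 1)"]) auto
          next
            case False
            then have "b \<ge> 1" using not_pos \<open>\<not> (i = 0 \<and> b = 0)\<close> by simp
            then show ?thesis by (intro that[of "Up (i + 1)"]) auto
          qed
        qed
        have "v i \<le> v (tgt h) + shift h" using adm h by (auto simp: admissible_def)
        then have b: "b - shift h < v (tgt h)" using less.prems h by linarith
        have "can_rep v h *\<^sub>v s \<in> S (tgt h)"
          using S(2) less.prems h by (auto simp: rep_stable_def)
        moreover have "height (tgt h) (b - shift h) < height i b"
          using height_arrow[of h "b - shift h"] h by simp
        ultimately have "(can_rep v h *\<^sub>v s) $ (b - shift h) = 0"
          using less.hyps b by blast
        moreover have "(can_rep v h *\<^sub>v s) $ (b - shift h) = s $ b"
          using can_rep_mult_vec[of s v h "b - shift h"] s h b less.prems by simp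
        ultimately show ?thesis by simp
      qed
    qed
    have "s = 0\<^sub>v (v i)" if "s \<in> S i" for s
    proof (rule eq_vecI)
      have "s \<in> carrier_vec (v i)" using sub that by blast
      then show "dim_vec s = dim_vec (0\<^sub>v (v i))" by simp
    qed (use zero[OF that] in simp)
    with sub(2)[of i] show ?thesis by blast
  qed
  ultimately show ?thesis
    unfolding Lambda_st_def
    by (intro CollectI case_prodI conjI allI impI; (elim conjE)?) (assumption, rule zero_S)
qed

section \<open>Coordinates on a stable point\<close>

text \<open>
  A stable point of arbitrary dimension \<open>v\<close> is now brought into canonical form. This also shows
  that \<open>v\<close> is admissible.
\<close>

locale stable_point =
  fixes v :: gdim and x :: qrep and j :: gmap
  assumes stable_point: "(x, j) \<in> Lambda_st v w0"
begin

lemma x_in_rep_space: "x \<in> rep_space v"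
  using stable_point by (simp add: Lambda_st_def Lambda_def Lambda_V_def)

lemma x_carrier: "x h \<in> carrier_mat (v (tgt h)) (v (src h))"
  using x_in_rep_space by (rule rep_spaceD)

lemma j_carrier: "j i \<in> carrier_mat (w0 i) (v i)"
  using stable_point by (simp add: Lambda_st_def Lambda_def gmaps_def)

definition T :: "int \<Rightarrow> complex mat" where
  "T i = x (Down (i + 1)) * x (Up (i + 1))"

lemma T_carrier: "T i \<in> carrier_mat (v i) (v i)"
  using x_carrier[of "Down (i + 1)"] x_carrier[of "Up (i + 1)"] by (simp add: T_def)

text \<open>
  By the moment equation the loops at a vertex through its two neighbours agree.
\<close>

lemma x_opp: "x h * x (opp h) = T (tgt h)"
proof -
  have "moment v x i = 0\<^sub>m (v i) (v i)" for i
    using stable_point by (simp add: Lambda_st_def Lambda_def Lambda_V_def)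
  then have "x (Down (i + 1)) * x (Up (i + 1)) = x (Up i) * x (Down i)" for i
    using moment_eq_zero_iff[OF x_in_rep_space] by blast
  then show ?thesis by (cases h) (simp_all add: T_def)
qed

lemma T_commute: "T (tgt h) * x h = x h * T (src h)"
  using assoc_mult_mat[OF x_carrier[of h] x_carrier[of "opp h", simplified] x_carrier[of h]]
    x_opp[of h] x_opp[of "opp h"] by simp

lemma T_pow_commute: "T (tgt h) ^\<^sub>m m * x h = x h * T (src h) ^\<^sub>m m"
proof (induction m)
  case 0
  show ?case using x_carrier[of h] T_carrier[of "tgt h"] T_carrier[of "src h"] by simp
next
  case (Suc m)
  note C = T_carrier[of "tgt h"] T_carrier[of "src h"] x_carrier[of h]
    pow_carrier_mat[OF T_carrier[of "tgt h"], of m] pow_carrier_mat[OF T_carrier[of "src h"], of m]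
  have "T (tgt h) ^\<^sub>m Suc m * x h = T (tgt h) ^\<^sub>m m * (T (tgt h) * x h)"
    using assoc_mult_mat[OF C(4) C(1) C(3)] by simp
  also have "\<dots> = (T (tgt h) ^\<^sub>m m * x h) * T (src h)"
    using assoc_mult_mat[OF C(4) C(3) C(2)] by (simp add: T_commute)
  also have "\<dots> = x h * T (src h) ^\<^sub>m Suc m"
    using assoc_mult_mat[OF C(3) C(5) C(2)] by (simp add: Suc.IH)
  finally show ?case .
qed

text \<open>
  The framing covector at $0$, pulled back along the straight path from \<open>n\<close>, respectively from
  \<open>- n\<close>, to $0$.
\<close>

primrec pos_cov :: "nat \<Rightarrow> complex mat" where
  "pos_cov 0 = j 0"
| "pos_cov (Suc n) = pos_cov n * x (Down (int n + 1))"

primrec neg_cov :: "nat \<Rightarrow> complex mat" where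
  "neg_cov 0 = j 0"
| "neg_cov (Suc n) = neg_cov n * x (Up (- int n))"

definition base_covec :: "int \<Rightarrow> complex mat" where
  "base_covec i = (if i \<ge> 0 then pos_cov (nat i) else neg_cov (nat (- i)))"

lemma base_covec_carrier: "base_covec i \<in> carrier_mat 1 (v i)"
proof -
  have "pos_cov n \<in> carrier_mat 1 (v (int n))" for n
  proof (induction n)
    case 0
    show ?case using j_carrier[of 0] by (simp add: w0_def)
  next
    case (Suc n)
    then show ?case using x_carrier[of "Down (int n + 1)"] by (simp add: add.commute)
  qed
  from this[of "nat i"] have pos: "i \<ge> 0 \<Longrightarrow> pos_cov (nat i) \<in> carrier_mat 1 (v i)" by simp
  have "neg_cov n \<in> carrier_mat 1 (v (- int n))" for n
  proof (induction n)
    case 0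
    show ?case using j_carrier[of 0] by (simp add: w0_def)
  next
    case (Suc n)
    have "- int n - 1 = - int (Suc n)" by simp
    then have "x (Up (- int n)) \<in> carrier_mat (v (- int n)) (v (- int (Suc n)))"
      using x_carrier[of "Up (- int n)"] by (metis src.simps(2) tgt.simps(2))
    then show ?case using Suc by (simp only: neg_cov.simps mult_carrier_mat)
  qed
  from this[of "nat (- i)"] have "i < 0 \<Longrightarrow> neg_cov (nat (- i)) \<in> carrier_mat 1 (v i)" by simp
  with pos show ?thesis by (simp add: base_covec_def)
qed

lemma base_covec_inward:
  assumes "shift h = 0"
  shows "base_covec (tgt h) * x h = base_covec (src h)"
proof (cases h)
  case (Down i)
  then have i: "i \<ge> 1" using assms by (simp split: if_splits)
  then have "nat i = Suc (nat (i - 1))" "int (nat (i - 1)) + 1 = i" by linarith+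
  then show ?thesis using i Down by (simp add: base_covec_def)
next
  case (Up i)
  then have i: "i \<le> 0" using assms by (simp split: if_splits)
  then have "nat (1 - i) = Suc (nat (- i))" "- int (nat (- i)) = i" by linarith+
  then show ?thesis using i Up by (cases "i = 0") (simp_all add: base_covec_def)
qed

text \<open>
  An arrow towards $0$ prolongs the straight path. An arrow away from $0$ starts a straight path
  with a step back, that is, it creates a loop, which the moment equation turns into \<open>T\<close>.
\<close>

lemma base_covec_arrow: "base_covec (tgt h) * x h = base_covec (src h) * T (src h) ^\<^sub>m shift h"
proof (cases "shift h = 0")
  case True
  then show ?thesis using base_covec_inward base_covec_carrier[of "src h"] T_carrier[of "src h"] by simp
next
  case False
  then have s: "shift h = Suc 0" "shift (opp h) = 0" using shift_opp[of h] by auto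
  have "base_covec (tgt h) * x h = base_covec (src h) * x (opp h) * x h"
    using base_covec_inward[OF s(2)] by simp
  also have "\<dots> = base_covec (src h) * T (src h)"
    using assoc_mult_mat[OF base_covec_carrier[of "src h"] x_carrier[of "opp h", simplified] x_carrier[of h]]
      x_opp[of "opp h"] by simp
  finally show ?thesis using s T_carrier[of "src h"] by simp
qed

definition covec :: "int \<Rightarrow> nat \<Rightarrow> complex mat" where
  "covec i m = base_covec i * T i ^\<^sub>m m"

lemma covec_carrier: "covec i m \<in> carrier_mat 1 (v i)"
  using base_covec_carrier[of i] pow_carrier_mat[OF T_carrier[of i], of m] by (simp add: covec_def)

lemma covec_Suc: "covec i (Suc m) = covec i m * T i"
  using assoc_mult_mat[OF base_covec_carrier pow_carrier_mat[OF T_carrier] T_carrier, of i m]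
  by (simp add: covec_def)

lemma covec_add: "covec i (m + k) = covec i m * T i ^\<^sub>m k"
proof (induction k)
  case 0
  show ?case using covec_carrier[of i m] T_carrier[of i] by simp
next
  case (Suc k)
  then show ?case
    using assoc_mult_mat[OF covec_carrier pow_carrier_mat[OF T_carrier] T_carrier, of i m k]
    by (simp add: covec_Suc)
qed

lemma covec_0_0: "covec 0 0 = j 0"
  using T_carrier[of 0] j_carrier[of 0] by (simp add: covec_def base_covec_def)

text \<open>
  This is the canonical form in disguise: the arrows pull the covectors back exactly as they
  pull back the coordinate functions of the canonical point.
\<close>

lemma covec_arrow: "covec (tgt h) m * x h = covec (src h) (m + shift h)"
proof -
  note C = base_covec_carrier[of "tgt h"] base_covec_carrier[of "src h"] x_carrier[of h]
    pow_carrier_mat[OF T_carrier[of "tgt h"], of m] pow_carrier_mat[OF T_carrier[of "src h"]]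
  have "covec (tgt h) m * x h = base_covec (tgt h) * (x h * T (src h) ^\<^sub>m m)"
    using assoc_mult_mat[OF C(1,4,3)] by (simp add: covec_def T_pow_commute)
  also have "\<dots> = base_covec (src h) * T (src h) ^\<^sub>m shift h * T (src h) ^\<^sub>m m"
    using assoc_mult_mat[OF C(1,3) C(5), of m] by (simp add: base_covec_arrow)
  also have "\<dots> = base_covec (src h) * T (src h) ^\<^sub>m (shift h + m)"
    using assoc_mult_mat[OF C(2) C(5) C(5), of "shift h" m]
    by (simp add: pow_mat_add[OF T_carrier[of "src h"]])
  finally show ?thesis by (simp add: covec_def add.commute)
qed

text \<open>
  A power of \<open>T\<close> is the map along the path that goes round the same loop many times, so nilpotency
  applies.
\<close>

lemma covec_eventually_zero: "\<exists>N. \<forall>m\<ge>N. covec i m = 0\<^sub>m 1 (v i)"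
proof -
  have "nilpotent_rep v x"
    using stable_point by (simp add: Lambda_st_def Lambda_def Lambda_V_def)
  then obtain N where N: "\<And>hs. hs \<noteq> [] \<Longrightarrow> length hs \<ge> N \<Longrightarrow>
      successively (\<lambda>h h'. tgt h = src h') hs \<Longrightarrow>
      path_map x hs = 0\<^sub>m (v (tgt (last hs))) (v (src (hd hs)))"
    unfolding nilpotent_rep_def by blast
  define loop where "loop m = concat (replicate m [Up (i + 1), Down (i + 1)])" for m
  have loop: "loop (Suc m) = Up (i + 1) # Down (i + 1) # loop m" for m
    by (simp add: loop_def)
  have path: "path_map x (loop (Suc m)) = T i ^\<^sub>m Suc m" for m
  proof (induction m)
    case 0
    have "loop (Suc 0) = [Up (i + 1), Down (i + 1)]" by (simp add: loop_def)
    then show ?case using T_carrier[of i] by (simp add: T_def)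
  next
    case (Suc m)
    have "path_map x (loop (Suc (Suc m))) =
        path_map x (loop (Suc m)) * x (Down (i + 1)) * x (Up (i + 1))"
      by (simp add: loop)
    also have "\<dots> = T i ^\<^sub>m Suc m * (x (Down (i + 1)) * x (Up (i + 1)))"
      using assoc_mult_mat[OF pow_carrier_mat[OF T_carrier] x_carrier[of "Down (i + 1)", simplified]
          x_carrier[of "Up (i + 1)", simplified], of "Suc m"]
      by (simp only: Suc.IH)
    finally show ?case by (simp add: T_def)
  qed
  have succ: "successively (\<lambda>h h'. tgt h = src h') (loop (Suc m))" for m
    by (induction m) (simp_all add: loop loop_def)
  have last: "last (loop (Suc m)) = Down (i + 1)" for m
    by (induction m) (simp_all add: loop loop_def)
  have len: "length (loop m) = 2 * m" for m
    by (induction m) (simp_all add: loop loop_def)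
  have "T i ^\<^sub>m m = 0\<^sub>m (v i) (v i)" if "m \<ge> Suc N" for m
  proof -
    obtain k where m: "m = Suc k" "k \<ge> N" using \<open>m \<ge> Suc N\<close> by (cases m) auto
    have "path_map x (loop (Suc k)) = 0\<^sub>m (v i) (v i)"
      using N[of "loop (Suc k)"] succ[of k] last[of k] len[of "Suc k"] m by (simp add: loop)
    then show ?thesis using path[of k] m by simp
  qed
  then have "covec i m = 0\<^sub>m 1 (v i)" if "m \<ge> Suc N" for m
    using that base_covec_carrier[of i] by (simp add: covec_def)
  then show ?thesis by blast
qed

lemma covec_zero_mono:
  assumes "covec i m = 0\<^sub>m 1 (v i)" "m \<le> k"
  shows "covec i k = 0\<^sub>m 1 (v i)"
  using assms(2)
proof (induction rule: dec_induct)
  case (step n)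
  then show ?case using covec_Suc[of i n] T_carrier[of i] by simp
qed (rule assms(1))

lemma covec_mult_vec:
  assumes "s \<in> carrier_vec (v i)"
  shows "(covec i m *\<^sub>v s) $ 0 = (\<Sum>b<v i. covec i m $$ (0, b) * s $ b)"
  using mult_mat_vec_index_sum[OF covec_carrier assms] by simp

lemma covec_mult_vec_eq_zero_iff: "covec i m *\<^sub>v s = 0\<^sub>v 1 \<longleftrightarrow> (covec i m *\<^sub>v s) $ 0 = 0"
proof
  assume "(covec i m *\<^sub>v s) $ 0 = 0"
  then show "covec i m *\<^sub>v s = 0\<^sub>v 1" using covec_carrier[of i m] by (intro eq_vecI) auto
qed simp

text \<open>
  The joint kernels of the covectors form a graded stable subspace that is killed by \<open>j\<close>.
\<close>

lemma covec_joint_kernel: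
  assumes s: "s \<in> carrier_vec (v i)" and ker: "\<And>m. covec i m *\<^sub>v s = 0\<^sub>v 1"
  shows "s = 0\<^sub>v (v i)"
proof -
  define S where "S i = {s \<in> carrier_vec (v i). \<forall>m. covec i m *\<^sub>v s = 0\<^sub>v 1}" for i
  have "graded_subspace v S"
    unfolding graded_subspace_def subspace_module_vec_iff
  proof (intro allI conjI ballI)
    fix i
    show "S i \<subseteq> carrier_vec (v i)" by (auto simp: S_def)
    have "covec i m *\<^sub>v 0\<^sub>v (v i) = 0\<^sub>v 1" for m
      unfolding covec_mult_vec_eq_zero_iff using covec_mult_vec[of "0\<^sub>v (v i)" i m] by simp
    then show "0\<^sub>v (v i) \<in> S i" by (simp add: S_def)
    fix a assume a: "a \<in> S i"
    have "covec i m *\<^sub>v (c \<cdot>\<^sub>v a) = 0\<^sub>v 1" for c m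
      using a mult_mat_vec[OF covec_carrier, of a i m c] by (auto simp: S_def)
    then show "c \<cdot>\<^sub>v a \<in> S i" for c
      using a by (simp add: S_def)
    fix b assume b: "b \<in> S i"
    have "covec i m *\<^sub>v (a + b) = 0\<^sub>v 1" for m
      using a b mult_add_distrib_mat_vec[OF covec_carrier, of a i b m] by (auto simp: S_def)
    then show "a + b \<in> S i"
      using a b by (simp add: S_def)
  qed
  moreover have "rep_stable x S"
    unfolding rep_stable_def
  proof (intro allI ballI)
    fix h s assume s: "s \<in> S (src h)"
    have "covec (tgt h) m *\<^sub>v (x h *\<^sub>v s) = covec (src h) (m + shift h) *\<^sub>v s" for m
      using s assoc_mult_mat_vec[OF covec_carrier x_carrier, of s h m] by (simp add: S_def covec_arrow)
    then show "x h *\<^sub>v s \<in> S (tgt h)"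
      using s x_carrier[of h] by (auto simp: S_def)
  qed
  moreover have "\<forall>i. \<forall>s\<in>S i. j i *\<^sub>v s = 0\<^sub>v (w0 i)"
  proof (intro allI ballI)
    fix i s assume s: "s \<in> S i"
    show "j i *\<^sub>v s = 0\<^sub>v (w0 i)"
    proof (cases "i = 0")
      case True
      then have "covec 0 0 *\<^sub>v s = 0\<^sub>v 1" using s by (simp add: S_def)
      with True show ?thesis by (simp add: covec_0_0 w0_def)
    next
      case False
      then show ?thesis using j_carrier[of i] by (intro eq_vecI) (auto simp: w0_def)
    qed
  qed
  ultimately have "S i = {0\<^sub>v (v i)}"
    using stable_point unfolding Lambda_st_def by blast
  then show ?thesis using s ker by (auto simp: S_def)
qed

text \<open>
  Let \<open>d\<close> be the index of the first vanishing covector. The covectors before it separate the points,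
  which gives $v_i \le d$. They are also independent: if the last of them is nonzero at \<open>s\<close>, then
  pairing them with \<open>s\<close>, \<open>T s\<close>, \<open>T\<^sup>2 s\<close>, \<open>\<dots>\<close> gives a triangular array. So $d \le v_i$.
\<close>

lemma covec_eq_zero_iff: "covec i m = 0\<^sub>m 1 (v i) \<longleftrightarrow> v i \<le> m"
proof -
  define d where "d = (LEAST m. covec i m = 0\<^sub>m 1 (v i))"
  have d: "covec i d = 0\<^sub>m 1 (v i)"
    unfolding d_def using covec_eventually_zero[of i] by (metis (mono_tags, lifting) LeastI order_refl)
  have least: "covec i m \<noteq> 0\<^sub>m 1 (v i)" if "m < d" for m
    using that not_less_Least unfolding d_def by blast
  have "d \<le> v i"
  proof (rule ccontr)
    assume "\<not> d \<le> v i"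
    then have less: "v i < d" by simp
    then obtain e where e: "d = Suc e" by (cases d) auto
    obtain b where b: "b < v i" "covec i e $$ (0, b) \<noteq> 0"
    proof (rule ccontr)
      assume "\<not> thesis"
      with that have "covec i e $$ (0, b) = 0" if "b < v i" for b using \<open>b < v i\<close> by blast
      then have "covec i e = 0\<^sub>m 1 (v i)"
        using covec_carrier[of i e] by (intro eq_matI) auto
      with least[of e] e show False by simp
    qed
    define s :: "complex Matrix.vec" where "s = unit_vec (v i) b"
    have s: "s \<in> carrier_vec (v i)" by (simp add: s_def)
    have "(covec i e *\<^sub>v s) $ 0 = covec i e $$ (0, b)"
      using b covec_carrier[of i e] by (simp add: s_def)
    then have nz: "(covec i e *\<^sub>v s) $ 0 \<noteq> 0" using b by simp
    define K where "K = mat (v i) d (\<lambda>(a, k). (T i ^\<^sub>m k *\<^sub>v s) $ a)"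
    have K: "K \<in> carrier_mat (v i) d" by (simp add: K_def)
    have col_K: "col K k = T i ^\<^sub>m k *\<^sub>v s" if "k < d" for k
      using that pow_carrier_mat[OF T_carrier[of i], of k] by (intro eq_vecI) (auto simp: K_def)
    \<comment> \<open>a linear relation between the vectors \<open>T ^ l s\<close> for \<open>l < d\<close>\<close>
    obtain z where z: "z \<in> carrier_vec d" "z \<noteq> 0\<^sub>v d" "K *\<^sub>v z = 0\<^sub>v (v i)"
      using wide_mat_kernel_nontrivial[OF K less] by blast
    have "\<exists>k. k < d \<and> z $ k \<noteq> 0"
    proof (rule ccontr)
      assume "\<nexists>k. k < d \<and> z $ k \<noteq> 0"
      then have "z = 0\<^sub>v d" using z(1) by (intro eq_vecI) auto
      with z(2) show False by simp
    qed
    then obtain k where k: "k < d" "z $ k \<noteq> 0" and min: "\<And>l. l < k \<Longrightarrow> \<not> (l < d \<and> z $ l \<noteq> 0)"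
      using exists_least_iff[of "\<lambda>k. k < d \<and> z $ k \<noteq> 0"] by blast
    \<comment> \<open>this covector isolates the first coefficient of the relation: its value on
      \<open>T ^ k s\<close> is that of \<open>covec i e\<close> on \<open>s\<close>, and it vanishes on the later vectors\<close>
    have entry: "(covec i (e - k) * K) $$ (0, l) = (covec i (e - k + l) *\<^sub>v s) $ 0" if "l < d" for l
    proof -
      have "(covec i (e - k) * K) $$ (0, l) = (covec i (e - k) *\<^sub>v col K l) $ 0"
        using covec_carrier[of i "e - k"] K that by simp
      also have "covec i (e - k) *\<^sub>v col K l = covec i (e - k + l) *\<^sub>v s"
        unfolding col_K[OF that] covec_add
        using assoc_mult_mat_vec[OF covec_carrier pow_carrier_mat[OF T_carrier] s] by simp
      finally show ?thesis .
    qed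
    have "((covec i (e - k) * K) *\<^sub>v z) $ 0 = (\<Sum>l<d. (covec i (e - k) * K) $$ (0, l) * z $ l)"
      by (rule mult_mat_vec_index_sum[OF mult_carrier_mat[OF covec_carrier K] z(1)]) simp
    also have "\<dots> = (\<Sum>l<d. if l = k then (covec i e *\<^sub>v s) $ 0 * z $ k else 0)"
    proof (rule sum.cong)
      fix l assume "l \<in> {..<d}"
      then have l: "l < d" by simp
      consider "l < k" | "l = k" | "k < l" by linarith
      then show "(covec i (e - k) * K) $$ (0, l) * z $ l = (if l = k then (covec i e *\<^sub>v s) $ 0 * z $ k else 0)"
      proof cases
        case 1
        then show ?thesis using min[of l] l by simp
      next
        case 2
        then show ?thesis using entry[OF l] k e by simp
      next
        case 3
        then have "d \<le> e - k + l" using k e by simp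
        then have "covec i (e - k + l) = 0\<^sub>m 1 (v i)" by (rule covec_zero_mono[OF d])
        then have "(covec i (e - k + l) *\<^sub>v s) $ 0 = 0" using s by simp
        then show ?thesis using entry[OF l] 3 by simp
      qed
    qed simp
    also have "\<dots> = (covec i e *\<^sub>v s) $ 0 * z $ k" using k by simp
    finally have "((covec i (e - k) * K) *\<^sub>v z) $ 0 \<noteq> 0" using nz k by simp
    moreover have "(covec i (e - k) * K) *\<^sub>v z = covec i (e - k) *\<^sub>v 0\<^sub>v (v i)"
      using assoc_mult_mat_vec[OF covec_carrier K z(1)] z(3) by simp
    moreover have "(covec i (e - k) *\<^sub>v 0\<^sub>v (v i)) $ 0 = 0"
      using covec_mult_vec[of "0\<^sub>v (v i)" i "e - k"] by simp
    ultimately show False by simp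
  qed
  moreover have "v i \<le> d"
  proof (rule ccontr)
    assume "\<not> v i \<le> d"
    then have less: "d < v i" by simp
    define M where "M = mat d (v i) (\<lambda>(m, b). covec i m $$ (0, b))"
    have M: "M \<in> carrier_mat d (v i)" by (simp add: M_def)
    obtain z where z: "z \<in> carrier_vec (v i)" "z \<noteq> 0\<^sub>v (v i)" "M *\<^sub>v z = 0\<^sub>v d"
      using wide_mat_kernel_nontrivial[OF M less] by blast
    have "covec i m *\<^sub>v z = 0\<^sub>v 1" for m
    proof -
      have "(covec i m *\<^sub>v z) $ 0 = 0"
      proof (cases "m < d")
        case True
        have "(M *\<^sub>v z) $ m = (\<Sum>b<v i. covec i m $$ (0, b) * z $ b)"
          using True z(1) by (simp add: M_def scalar_prod_def atLeast0LessThan)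
        then show ?thesis using covec_mult_vec[OF z(1), of m] z(3) True by simp
      next
        case False
        then have "covec i m = 0\<^sub>m 1 (v i)" using covec_zero_mono[OF d, of m] by simp
        then show ?thesis using z(1) by simp
      qed
      then show ?thesis by (simp only: covec_mult_vec_eq_zero_iff)
    qed
    with covec_joint_kernel[OF z(1)] z(2) show False by blast
  qed
  ultimately have "d = v i" by simp
  then show ?thesis using least[of m] covec_zero_mono[OF d, of m] by (meson not_le)
qed

text \<open>
  By \<open>covec_arrow\<close>, an arrow pulls a vanishing covector back to a vanishing covector, and the first
  vanishing index is the dimension.
\<close>

lemma dims_admissible: "admissible v"
  unfolding admissible_def
proof
  fix h
  have "covec (tgt h) (v (tgt h)) = 0\<^sub>m 1 (v (tgt h))" by (simp only: covec_eq_zero_iff)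
  then have "covec (src h) (v (tgt h) + shift h) = 0\<^sub>m 1 (v (src h))"
    using covec_arrow[of h "v (tgt h)"] x_carrier[of h] by simp
  then show "v (src h) \<le> v (tgt h) + shift h" by (simp only: covec_eq_zero_iff)
qed

text \<open>
  The coordinate change whose coordinate functions are the nonzero covectors.
\<close>

definition coord :: gmap where
  "coord i = mat (v i) (v i) (\<lambda>(a, b). covec i a $$ (0, b))"

lemma coord_carrier: "coord i \<in> carrier_mat (v i) (v i)"
  by (simp add: coord_def)

lemma coord_in_G_V: "coord \<in> G_V v"
  unfolding G_V_def
proof (intro CollectI allI trivial_kernel_imp_Units_ring_mat coord_carrier)
  fix i and z :: "complex Matrix.vec"
  assume z: "z \<in> carrier_vec (v i)" "coord i *\<^sub>v z = 0\<^sub>v (v i)"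
  show "z = 0\<^sub>v (v i)"
  proof (rule covec_joint_kernel[OF z(1)])
    fix m
    have "(covec i m *\<^sub>v z) $ 0 = 0"
    proof (cases "m < v i")
      case True
      have "(coord i *\<^sub>v z) $ m = (\<Sum>b<v i. covec i m $$ (0, b) * z $ b)"
        using True z(1) by (simp add: coord_def scalar_prod_def atLeast0LessThan)
      then show ?thesis using covec_mult_vec[OF z(1), of m] z(2) True by simp
    next
      case False
      then have "covec i m = 0\<^sub>m 1 (v i)" by (simp only: covec_eq_zero_iff)
      then show ?thesis using z(1) by simp
    qed
    then show "covec i m *\<^sub>v z = 0\<^sub>v 1" by (simp only: covec_mult_vec_eq_zero_iff)
  qed
qed

lemma coord_x: "coord (tgt h) * x h = can_rep v h * coord (src h)"
proof (rule eq_matI)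
  note x = x_carrier[of h]
  fix a b
  assume "a < dim_row (can_rep v h * coord (src h))" "b < dim_col (can_rep v h * coord (src h))"
  then have ab: "a < v (tgt h)" "b < v (src h)" by (simp_all add: can_rep_def coord_def)
  have "(coord (tgt h) * x h) $$ (a, b) = (\<Sum>c<v (tgt h). covec (tgt h) a $$ (0, c) * x h $$ (c, b))"
    using ab x by (simp add: coord_def scalar_prod_def atLeast0LessThan)
  also have "\<dots> = (covec (tgt h) a * x h) $$ (0, b)"
    using ab x covec_carrier[of "tgt h" a] by (simp add: scalar_prod_def atLeast0LessThan)
  also have "\<dots> = covec (src h) (a + shift h) $$ (0, b)" by (simp add: covec_arrow)
  also have "\<dots> = (if a + shift h < v (src h) then coord (src h) $$ (a + shift h, b) else 0)"
  proof (cases "a + shift h < v (src h)")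
    case False
    then have "covec (src h) (a + shift h) = 0\<^sub>m 1 (v (src h))" by (simp only: covec_eq_zero_iff)
    with False ab show ?thesis by simp
  qed (use ab in \<open>simp add: coord_def\<close>)
  also have "\<dots> = (can_rep v h * coord (src h)) $$ (a, b)"
    using can_rep_mult_mat[where v = v, OF coord_carrier ab] by simp
  finally show "(coord (tgt h) * x h) $$ (a, b) = (can_rep v h * coord (src h)) $$ (a, b)" .
qed (use x_carrier[of h] in \<open>simp_all add: can_rep_def coord_def\<close>)

lemma coord_j: "j i = can_framing v i * coord i"
proof (rule eq_matI)
  fix a b
  assume ab: "a < dim_row (can_framing v i * coord i)" "b < dim_col (can_framing v i * coord i)"
  then have i: "i = 0" "a = 0" and b: "b < v 0"
    by (auto simp: can_framing_def coord_def w0_def split: if_splits)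
  have "(can_framing v 0 * coord 0) $$ (0, b) = (can_framing v 0 *\<^sub>v col (coord 0) b) $ 0"
    using b by (simp add: can_framing_def coord_def w0_def)
  also have "\<dots> = col (coord 0) b $ 0"
    by (rule can_framing_mult_vec) (use b in \<open>simp_all add: coord_def\<close>)
  also have "\<dots> = j 0 $$ (0, b)" using b by (simp add: coord_def covec_0_0)
  finally show "j i $$ (a, b) = (can_framing v i * coord i) $$ (a, b)" using i by simp
qed (use j_carrier[of i] in \<open>simp_all add: can_framing_def coord_def\<close>)

end

section \<open>Orbits\<close>

definition gprod :: "gmap \<Rightarrow> gmap \<Rightarrow> gmap" where
  "gprod g h = (\<lambda>i. g i * h i)"

definition ginv :: "gdim \<Rightarrow> gmap \<Rightarrow> gmap" where
  "ginv v g = (\<lambda>i. inv\<^bsub>End_ring v i\<^esub> (g i))"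

lemma G_V_D:
  assumes "g \<in> G_V v"
  shows "g i \<in> carrier_mat (v i) (v i)" "ginv v g i \<in> carrier_mat (v i) (v i)"
    "g i * ginv v g i = 1\<^sub>m (v i)" "ginv v g i * g i = 1\<^sub>m (v i)" "ginv v g \<in> G_V v"
  using Units_ring_mat_inv[of "g _" "v _" "()"] assms by (simp_all add: G_V_def ginv_def)

lemma gprod_in_G_V:
  assumes "g \<in> G_V v" "h \<in> G_V v"
  shows "gprod g h \<in> G_V v"
  unfolding G_V_def gprod_def
proof (intro CollectI allI)
  fix i
  interpret ring "End_ring v i" by (rule ring_mat)
  show "g i * h i \<in> Units (End_ring v i)"
    using Units_m_closed[of "g i" "h i"] assms by (simp add: ring_mat_simps G_V_def)
qed

lemma one_in_G_V: "(\<lambda>i. 1\<^sub>m (v i)) \<in> G_V v"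
  unfolding G_V_def by (auto intro!: Units_ring_matI[of _ _ "1\<^sub>m _"])

text \<open>
  Clearing the inverses turns the action into intertwining relations, which compose without any
  computation with inverses.
\<close>

lemma act_eq_iff:
  assumes g: "g \<in> G_V v" and x: "x \<in> rep_space v" and x': "x' \<in> rep_space v"
    and j: "j \<in> gmaps v w" and j': "j' \<in> gmaps v w"
  shows "act v g (x, j) = (x', j') \<longleftrightarrow>
    (\<forall>h. g (tgt h) * x h = x' h * g (src h)) \<and> (\<forall>i. j i = j' i * g i)"
proof -
  note G = G_V_D[OF g]
  have xc: "g (tgt h) * x h \<in> carrier_mat (v (tgt h)) (v (src h))"
    "x' h \<in> carrier_mat (v (tgt h)) (v (src h))" for h
    using G(1)[of "tgt h"] rep_spaceD[OF x, of h] rep_spaceD[OF x', of h] by auto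
  have jc: "j i \<in> carrier_mat (w i) (v i)" "j' i \<in> carrier_mat (w i) (v i)" for i
    using j j' by (auto simp: gmaps_def)
  have "g (tgt h) * x h * ginv v g (src h) = x' h \<longleftrightarrow> g (tgt h) * x h = x' h * g (src h)" for h
    using cancel_right_inverse[OF xc(1)[of h] G(2,1,4)[of "src h"]]
      cancel_right_inverse[OF xc(2)[of h] G(1,2,3)[of "src h"]] by metis
  moreover have "j i * ginv v g i = j' i \<longleftrightarrow> j i = j' i * g i" for i
    using cancel_right_inverse[OF jc(1)[of i] G(2,1,4)[of i]]
      cancel_right_inverse[OF jc(2)[of i] G(1,2,3)[of i]] by metis
  ultimately show ?thesis
    by (simp add: act_def fun_eq_iff ginv_def)
qed

lemma act_closed:
  assumes g: "g \<in> G_V v" and x: "x \<in> rep_space v" and j: "j \<in> gmaps v w"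
  obtains x' j' where "act v g (x, j) = (x', j')" "x' \<in> rep_space v" "j' \<in> gmaps v w"
proof -
  note G = G_V_D[OF g]
  have "(\<lambda>h. g (tgt h) * x h * ginv v g (src h)) \<in> rep_space v"
    unfolding rep_space_def using G(1,2) rep_spaceD[OF x] by (blast intro: mult_carrier_mat)
  moreover have "(\<lambda>i. j i * ginv v g i) \<in> gmaps v w"
    using j G(2) unfolding gmaps_def by (blast intro: mult_carrier_mat)
  ultimately show ?thesis
    using that by (simp add: act_def ginv_def)
qed

lemma act_one:
  assumes x: "x \<in> rep_space v" and j: "j \<in> gmaps v w"
  shows "act v (\<lambda>i. 1\<^sub>m (v i)) (x, j) = (x, j)"
proof -
  have "1\<^sub>m (v (tgt h)) * x h = x h * 1\<^sub>m (v (src h))" for h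
    using rep_spaceD[OF x, of h] by simp
  moreover have "j i = j i * 1\<^sub>m (v i)" for i
  proof -
    have "j i \<in> carrier_mat (w i) (v i)" using j by (simp add: gmaps_def)
    then show ?thesis by simp
  qed
  ultimately show ?thesis
    using act_eq_iff[OF one_in_G_V x x j j] by blast
qed

lemma act_act:
  assumes g: "g \<in> G_V v" and h: "h \<in> G_V v" and x: "x \<in> rep_space v" and j: "j \<in> gmaps v w"
  shows "act v g (act v h (x, j)) = act v (gprod g h) (x, j)"
proof -
  obtain x' j' where 1: "act v h (x, j) = (x', j')" "x' \<in> rep_space v" "j' \<in> gmaps v w"
    using act_closed[OF h x j] .
  obtain x'' j'' where 2: "act v g (x', j') = (x'', j'')" "x'' \<in> rep_space v" "j'' \<in> gmaps v w"
    using act_closed[OF g 1(2,3)] .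
  note e1 = 1(1)[unfolded act_eq_iff[OF h x 1(2) j 1(3)]]
  note e2 = 2(1)[unfolded act_eq_iff[OF g 1(2) 2(2) 1(3) 2(3)]]
  note G = G_V_D(1)[OF g] and H = G_V_D(1)[OF h]
  have "g (tgt a) * h (tgt a) * x a = x'' a * (g (src a) * h (src a))" for a
  proof -
    have "g (tgt a) * h (tgt a) * x a = g (tgt a) * (x' a * h (src a))"
      using assoc_mult_mat[OF G H rep_spaceD[OF x]] e1 by simp
    also have "\<dots> = x'' a * g (src a) * h (src a)"
      using assoc_mult_mat[OF G rep_spaceD[OF 1(2)] H] e2 by simp
    also have "\<dots> = x'' a * (g (src a) * h (src a))"
      by (rule assoc_mult_mat[OF rep_spaceD[OF 2(2)] G H])
    finally show ?thesis .
  qed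
  moreover have "j i = j'' i * (g i * h i)" for i
  proof -
    have "j'' i \<in> carrier_mat (w i) (v i)" using 2(3) by (simp add: gmaps_def)
    then have "j'' i * (g i * h i) = j'' i * g i * h i"
      by (rule assoc_mult_mat[symmetric, OF _ G H])
    then show ?thesis using e1 e2 by simp
  qed
  ultimately have "act v (gprod g h) (x, j) = (x'', j'')"
    unfolding act_eq_iff[OF gprod_in_G_V[OF g h] x 2(2) j 2(3)] by (simp add: gprod_def)
  then show ?thesis using 1(1) 2(1) by simp
qed

lemma gprod_ginv_cancel:
  assumes g: "g \<in> G_V v" and h: "h \<in> G_V v"
  shows "gprod (gprod h (ginv v g)) g = h"
  using cancel_right_inverse[OF G_V_D(1)[OF h] G_V_D(2,1,4)[OF g]]
  by (simp add: gprod_def)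

lemma orbit_of_act:
  assumes g: "g \<in> G_V v" and x: "x \<in> rep_space v" and j: "j \<in> gmaps v w"
  shows "orbit_of v (act v g (x, j)) = orbit_of v (x, j)"
proof (intro equalityI subsetI)
  fix p assume "p \<in> orbit_of v (act v g (x, j))"
  then obtain h where "h \<in> G_V v" "p = act v h (act v g (x, j))" by (auto simp: orbit_of_def)
  then show "p \<in> orbit_of v (x, j)"
    using act_act[OF _ g x j] gprod_in_G_V[OF _ g] by (auto simp: orbit_of_def)
next
  fix p assume "p \<in> orbit_of v (x, j)"
  then obtain h where h: "h \<in> G_V v" "p = act v h (x, j)" by (auto simp: orbit_of_def)
  define k where "k = gprod h (ginv v g)"
  have k: "k \<in> G_V v" unfolding k_def using h(1) G_V_D(5)[OF g] by (rule gprod_in_G_V)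
  have "p = act v k (act v g (x, j))"
    using act_act[OF k g x j] gprod_ginv_cancel[OF g h(1)] h(2) by (simp add: k_def)
  with k show "p \<in> orbit_of v (act v g (x, j))" by (auto simp: orbit_of_def)
qed

definition gpush :: "gmap \<Rightarrow> gsub \<Rightarrow> gsub" where
  "gpush g S = (\<lambda>i. (\<lambda>s. g i *\<^sub>v s) ` S i)"

lemma gpush_gpush:
  assumes g: "g \<in> G_V v" and h: "h \<in> G_V v" and S: "\<And>i. S i \<subseteq> carrier_vec (v i)"
  shows "gpush g (gpush h S) = gpush (gprod g h) S"
proof -
  have "g i *\<^sub>v (h i *\<^sub>v s) = g i * h i *\<^sub>v s" if "s \<in> S i" for i s
    using assoc_mult_mat_vec[OF G_V_D(1)[OF g] G_V_D(1)[OF h], of s i] S[of i] that by auto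
  then show ?thesis by (auto simp: gpush_def gprod_def fun_eq_iff image_image)
qed

lemma triple_orbit_eq: "triple_orbit v (p, S) = (\<lambda>g. (act v g p, gpush g S)) ` G_V v"
  by (simp add: triple_orbit_def gpush_def)

lemma triple_orbit_act:
  assumes g: "g \<in> G_V v" and x: "x \<in> rep_space v" and j: "j \<in> gmaps v w"
    and S: "\<And>i. S i \<subseteq> carrier_vec (v i)"
  shows "triple_orbit v (act v g (x, j), gpush g S) = triple_orbit v ((x, j), S)"
proof (intro equalityI subsetI)
  fix p assume "p \<in> triple_orbit v (act v g (x, j), gpush g S)"
  then obtain h where "h \<in> G_V v" "p = (act v h (act v g (x, j)), gpush h (gpush g S))"
    by (auto simp: triple_orbit_eq)
  then show "p \<in> triple_orbit v ((x, j), S)"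
    using act_act[OF _ g x j] gpush_gpush[where S = S, OF _ g S] gprod_in_G_V[OF _ g]
    by (auto simp: triple_orbit_eq)
next
  fix p assume "p \<in> triple_orbit v ((x, j), S)"
  then obtain h where h: "h \<in> G_V v" "p = (act v h (x, j), gpush h S)"
    by (auto simp: triple_orbit_eq)
  define k where "k = gprod h (ginv v g)"
  have k: "k \<in> G_V v" unfolding k_def using h(1) G_V_D(5)[OF g] by (rule gprod_in_G_V)
  have "p = (act v k (act v g (x, j)), gpush k (gpush g S))"
    using act_act[OF k g x j] gpush_gpush[where S = S, OF k g S] gprod_ginv_cancel[OF g h(1)] h(2)
    by (simp add: k_def)
  with k show "p \<in> triple_orbit v (act v g (x, j), gpush g S)"
    by (auto simp: triple_orbit_eq)
qed

definition can_orbit :: "gdim \<Rightarrow> (qrep \<times> gmap) set" where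
  "can_orbit v = orbit_of v (can_rep v, can_framing v)"

lemma (in stable_point) j_in_gmaps: "j \<in> gmaps v w0"
  using j_carrier by (simp add: gmaps_def)

lemma (in stable_point) act_coord: "act v coord (x, j) = (can_rep v, can_framing v)"
  using act_eq_iff[OF coord_in_G_V x_in_rep_space can_rep_in_rep_space j_in_gmaps can_framing_in_gmaps]
    coord_x coord_j by blast

text \<open>
  The right-hand side depends on the dimension alone, so any two stable points lie in one orbit.
\<close>

lemma (in stable_point) orbit_eq_can_orbit: "orbit_of v (x, j) = can_orbit v"
  using orbit_of_act[OF coord_in_G_V x_in_rep_space j_in_gmaps]
  by (simp add: act_coord can_orbit_def)

lemma quiver_variety_w0_subset: "quiver_variety v w0 \<subseteq> {can_orbit v}"
  using stable_point.orbit_eq_can_orbit by (force simp: quiver_variety_def stable_point_def)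

lemma quiver_variety_w0_imp_admissible: "quiver_variety v w0 \<noteq> {} \<Longrightarrow> admissible v"
  using stable_point.dims_admissible by (force simp: quiver_variety_def stable_point_def)

lemma quiver_variety_w0_eq:
  assumes "admissible v" "v \<in> gdims"
  shows "quiver_variety v w0 = {can_orbit v}"
  using can_rep_in_Lambda_st[OF assms] quiver_variety_w0_subset[of v]
  by (auto simp: quiver_variety_def can_orbit_def)

section \<open>The Hecke correspondence\<close>

lemma frame_subspace:
  assumes "\<iota> \<in> gframes u v"
  shows "graded_subspace v (gimage u \<iota>)" "gdim_of v (gimage u \<iota>) = u"
    "gimage u \<iota> i \<subseteq> carrier_vec (v i)"
proof -
  have \<iota>: "\<iota> i \<in> carrier_mat (v i) (u i)" "inj_on (\<lambda>s. \<iota> i *\<^sub>v s) (carrier_vec (u i))" for i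
    using assms by (auto simp: gframes_def gmaps_def)
  show sub: "graded_subspace v (gimage u \<iota>)"
    using subspace_range_mat[OF \<iota>] by (simp add: graded_subspace_def gimage_def)
  show "gdim_of v (gimage u \<iota>) = u"
    using dim_range_inj_mat[OF \<iota>] by (simp add: gdim_of_def gimage_def fun_eq_iff)
  show "gimage u \<iota> i \<subseteq> carrier_vec (v i)"
    using sub by (simp add: graded_subspace_def subspace_module_vec_iff)
qed

definition incl :: "gdim \<Rightarrow> gdim \<Rightarrow> gmap" where
  "incl u v = (\<lambda>i. rect_id (v i) (u i))"

text \<open>
  For dimension vectors of finite support this is the only case in which the correspondence can be
  nonempty, since it maps to the quiver varieties of both dimensions.
\<close>

locale hecke_dims =
  fixes u :: gdim and k :: int and v :: gdim
  assumes v: "v = raise k u" and adm_u: "admissible u" and adm_v: "admissible v" and fin_v: "v \<in> gdims"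
begin

lemma u_le_v: "u i \<le> v i"
  by (simp add: v raise_def)

lemma v_k: "v k = Suc (u k)"
  by (simp add: v raise_def unit_gdim_def)

lemma v_eq_u: "i \<noteq> k \<Longrightarrow> v i = u i"
  by (simp add: v raise_def unit_gdim_def)

lemma incl_carrier: "incl u v i \<in> carrier_mat (v i) (u i)"
  by (simp add: incl_def)

lemma incl_in_gframes: "incl u v \<in> gframes u v"
  using inj_on_rect_id[OF u_le_v] by (simp add: gframes_def gmaps_def incl_def)

lemma gimage_incl:
  "gimage u (incl u v) i = {s \<in> carrier_vec (v i). \<forall>a. u i \<le> a \<and> a < v i \<longrightarrow> s $ a = 0}"
  using range_rect_id[OF u_le_v] by (simp add: gimage_def incl_def)

lemma gimage_incl_k: "gimage u (incl u v) k = {s \<in> carrier_vec (v k). s $ u k = 0}"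
proof -
  have "u k \<le> a \<and> a < v k \<longleftrightarrow> a = u k" for a using v_k by auto
  then show ?thesis unfolding gimage_incl by simp
qed

lemma gimage_incl_other: "i \<noteq> k \<Longrightarrow> gimage u (incl u v) i = carrier_vec (v i)"
  using v_eq_u[of i] by (auto simp: gimage_incl)

text \<open>
  The canonical points are compatible with the inclusion of the first \<open>u i\<close> basis vectors at each
  vertex because \<open>u\<close> is admissible: a vector among the first \<open>u (src h)\<close> is moved to $0$ or to one
  among the first \<open>u (tgt h)\<close>.
\<close>

lemma incl_intertwines: "can_rep v h * incl u v (src h) = incl u v (tgt h) * can_rep u h"
proof (rule eq_matI)
  fix a b
  assume "a < dim_row (incl u v (tgt h) * can_rep u h)" "b < dim_col (incl u v (tgt h) * can_rep u h)"
  then have ab: "a < v (tgt h)" "b < u (src h)" by (simp_all add: incl_def rect_id_def can_rep_def)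
  have le: "u (src h) \<le> u (tgt h) + shift h" using adm_u by (simp add: admissible_def)
  have "(can_rep v h * incl u v (src h)) $$ (a, b) = (if b = a + shift h then 1 else 0)"
    using can_rep_mult_mat[where v = v, OF incl_carrier ab] ab u_le_v[of "src h"]
    by (auto simp: incl_def rect_id_def)
  also have "\<dots> = (incl u v (tgt h) * can_rep u h) $$ (a, b)"
    using rect_id_mult_mat[OF can_rep_carrier[of u h] ab] ab le
    by (auto simp: incl_def can_rep_def)
  finally show "(can_rep v h * incl u v (src h)) $$ (a, b) =
      (incl u v (tgt h) * can_rep u h) $$ (a, b)" .
qed (simp_all add: incl_def rect_id_def can_rep_def)

lemma can_framing_incl: "can_framing v i * incl u v i = can_framing u i"
proof (rule eq_matI)
  fix a b assume "a < dim_row (can_framing u i)" "b < dim_col (can_framing u i)"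
  then have i: "i = 0" "a = 0" and b: "b < u 0" by (auto simp: can_framing_def w0_def split: if_splits)
  have "(can_framing v 0 * incl u v 0) $$ (0, b) = (can_framing v 0 *\<^sub>v col (incl u v 0) b) $ 0"
    using b by (simp add: can_framing_def incl_def rect_id_def w0_def)
  also have "\<dots> = col (incl u v 0) b $ 0"
    by (rule can_framing_mult_vec) (use b u_le_v[of 0] in \<open>simp_all add: incl_def rect_id_def\<close>)
  also have "\<dots> = can_framing u 0 $$ (0, b)"
    using b u_le_v[of 0] by (auto simp: incl_def rect_id_def can_framing_def w0_def)
  finally show "(can_framing v i * incl u v i) $$ (a, b) = can_framing u i $$ (a, b)" using i by simp
qed (simp_all add: can_framing_def incl_def rect_id_def)

lemma incl_stable: "rep_stable (can_rep v) (gimage u (incl u v))"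
  unfolding rep_stable_def
proof (intro allI ballI)
  fix h s assume "s \<in> gimage u (incl u v) (src h)"
  then obtain t where t: "t \<in> carrier_vec (u (src h))" "s = incl u v (src h) *\<^sub>v t"
    by (auto simp: gimage_def)
  note C = can_rep_carrier[of u h]
  have "can_rep v h *\<^sub>v s = incl u v (tgt h) * can_rep u h *\<^sub>v t"
    using assoc_mult_mat_vec[OF can_rep_carrier[of v h] incl_carrier t(1)] t(2) incl_intertwines[of h]
    by simp
  also have "\<dots> = incl u v (tgt h) *\<^sub>v (can_rep u h *\<^sub>v t)"
    by (rule assoc_mult_mat_vec[OF incl_carrier C t(1)])
  finally show "can_rep v h *\<^sub>v s \<in> gimage u (incl u v) (tgt h)"
    using mult_mat_vec_carrier[OF C t(1)] by (simp add: gimage_def)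
qed

abbreviation "can_triple \<equiv> ((can_rep v, can_framing v), gimage u (incl u v))"

lemma can_triple_in_hecke_triples: "can_triple \<in> hecke_triples u w0 k"
  using can_rep_in_Lambda_st[OF adm_v fin_v] frame_subspace(1,2)[OF incl_in_gframes] incl_stable
  by (simp add: hecke_triples_def v[symmetric])

text \<open>
  A subspace of dimension \<open>u\<close> is everything away from \<open>k\<close>, so by stability it contains the image of
  an arrow into \<open>k\<close>. In the canonical coordinates this image contains the hyperplane spanned by all
  basis vectors at \<open>k\<close> but the last. There is no room for more.
\<close>

lemma coord_image_stable_subspace:
  assumes "((x, j), S) \<in> hecke_triples u w0 k"
  shows "gpush (stable_point.coord v x j) S = gimage u (incl u v)"
proof
  have st: "(x, j) \<in> Lambda_st v w0" and sub: "graded_subspace v S" and dim: "gdim_of v S = u"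
    and stab: "rep_stable x S"
    using assms by (auto simp: hecke_triples_def v[symmetric])
  interpret stable_point v x j by standard (rule st)
  note g = G_V_D[OF coord_in_G_V]
  have S: "S i \<subseteq> carrier_vec (v i)" "0\<^sub>v (v i) \<in> S i" "a \<in> S i \<Longrightarrow> b \<in> S i \<Longrightarrow> a + b \<in> S i"
    "a \<in> S i \<Longrightarrow> c \<cdot>\<^sub>v a \<in> S i" for i a b c
    using sub by (auto simp: graded_subspace_def subspace_module_vec_iff)
  have sub': "VectorSpace.subspace class_ring (S i) (module_vec TYPE(complex) (v i))"
    and dim': "vectorspace.dim class_ring ((module_vec TYPE(complex) (v i))\<lparr>carrier := S i\<rparr>) = u i" for i
    using sub dim by (auto simp: graded_subspace_def gdim_of_def fun_eq_iff)
  have coord_inv: "coord i *\<^sub>v (ginv v coord i *\<^sub>v s) = s" "ginv v coord i *\<^sub>v (coord i *\<^sub>v s) = s"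
    "ginv v coord i *\<^sub>v s \<in> carrier_vec (v i)" "coord i *\<^sub>v s \<in> carrier_vec (v i)"
    if s: "s \<in> carrier_vec (v i)" for i s
    using assoc_mult_mat_vec[OF g(1) g(2) s] assoc_mult_mat_vec[OF g(2) g(1) s] g(3,4)[of i] s
      mult_mat_vec_carrier[OF g(2) s] mult_mat_vec_carrier[OF g(1) s] by simp_all
  have full: "S i = carrier_vec (v i)" if "i \<noteq> k" for i
    by (rule subspace_eq_carrier_vec[OF sub' trans[OF dim' v_eq_u[OF that, symmetric]]])
  have "module_vec TYPE(complex) (v k)\<lparr>carrier := carrier_vec (v k)\<rparr> = module_vec TYPE(complex) (v k)"
    by (simp add: module_vec_def)
  then have "S k \<noteq> carrier_vec (v k)"
    using dim'[of k] vec_space.dim_is_n[of "v k", where ?'a = complex] v_k by auto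
  \<comment> \<open>by dimension the subspace at \<open>k\<close> is proper, so it misses some \<open>y\<close>\<close>
  then obtain y where y: "y \<in> carrier_vec (v k)" "y \<notin> S k" using S(1)[of k] by blast
  have hyp: "s \<in> gpush coord S k" if s: "s \<in> carrier_vec (v k)" "s $ u k = 0" for s
  proof -
    define h where "h = Up k"
    have h: "tgt h = k" "src h \<noteq> k" by (simp_all add: h_def)
    \<comment> \<open>the vector that \<open>can_rep v h\<close> moves to \<open>s\<close>\<close>
    define r where "r = vec (v (src h))
      (\<lambda>b. if shift h \<le> b \<and> b - shift h < v k then s $ (b - shift h) else 0)"
    have r: "r \<in> carrier_vec (v (src h))" by (simp add: r_def)
    have le: "v k \<le> v (src h) + shift (opp h)"
      using adm_v h(1) unfolding admissible_def by (metis opp_simps(1,2))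
    have can_r: "can_rep v h *\<^sub>v r = s"
    proof (rule eq_vecI)
      fix a assume "a < dim_vec s"
      then have a: "a < v k" using s by simp
      have "(can_rep v h *\<^sub>v r) $ a = (if a + shift h < v (src h) then r $ (a + shift h) else 0)"
        by (rule can_rep_mult_vec[where v = v, OF r]) (simp add: h a)
      also have "\<dots> = s $ a"
      proof (cases "a + shift h < v (src h)")
        case False
        then have "a = u k" using a le shift_opp[of h] v_k by linarith
        with False s show ?thesis by simp
      qed (use a in \<open>simp add: r_def\<close>)
      finally show "(can_rep v h *\<^sub>v r) $ a = s $ a" .
    qed (use s h in \<open>simp add: can_rep_def\<close>)
    define q where "q = ginv v coord (src h) *\<^sub>v r"
    have q: "q \<in> carrier_vec (v (src h))" "coord (src h) *\<^sub>v q = r"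
      using coord_inv[OF r] by (simp_all add: q_def)
    have "coord (tgt h) *\<^sub>v (x h *\<^sub>v q) = coord (tgt h) * x h *\<^sub>v q"
      by (rule assoc_mult_mat_vec[OF g(1)[of "tgt h"] x_carrier[of h] q(1), symmetric])
    also have "\<dots> = can_rep v h *\<^sub>v (coord (src h) *\<^sub>v q)"
      unfolding coord_x by (rule assoc_mult_mat_vec[OF can_rep_carrier[of v h] g(1)[of "src h"] q(1)])
    finally have "coord k *\<^sub>v (x h *\<^sub>v q) = can_rep v h *\<^sub>v (coord (src h) *\<^sub>v q)"
      by (simp only: h(1))
    then have "coord k *\<^sub>v (x h *\<^sub>v q) = s" by (simp only: q(2) can_r)
    moreover have "x h *\<^sub>v q \<in> S k"
      using stab full[OF h(2)] q(1) h(1) unfolding rep_stable_def by metis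
    ultimately show ?thesis by (auto simp: gpush_def)
  qed
  have "gpush coord S k = {s \<in> carrier_vec (v k). s $ u k = 0}"
  proof (intro equalityI subsetI)
    fix s assume "s \<in> gpush coord S k"
    then obtain t where t: "t \<in> S k" "s = coord k *\<^sub>v t" by (auto simp: gpush_def)
    have tc: "t \<in> carrier_vec (v k)" using t S by blast
    have s: "s \<in> carrier_vec (v k)" using coord_inv(4)[OF tc] t(2) by simp
    have "s $ u k = 0"
    proof (rule ccontr)
      assume nz: "s $ u k \<noteq> 0"
      define z where "z = coord k *\<^sub>v y"
      have z: "z \<in> carrier_vec (v k)" using coord_inv(4)[OF y(1)] by (simp add: z_def)
      \<comment> \<open>subtracting \<open>c\<close> times \<open>s\<close> moves \<open>z\<close> into the hyperplane\<close>
      define c where "c = z $ u k / s $ u k"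
      have "z - c \<cdot>\<^sub>v s \<in> gpush coord S k"
        using z s nz v_k by (intro hyp) (simp_all add: c_def)
      then obtain t' where t': "t' \<in> S k" "z - c \<cdot>\<^sub>v s = coord k *\<^sub>v t'" by (auto simp: gpush_def)
      have t'c: "t' \<in> carrier_vec (v k)" using t' S by blast
      have "z = (z - c \<cdot>\<^sub>v s) + c \<cdot>\<^sub>v s" using z s by (intro eq_vecI) auto
      also have "\<dots> = coord k *\<^sub>v (t' + c \<cdot>\<^sub>v t)"
        using mult_add_distrib_mat_vec[OF g(1) t'c, of "c \<cdot>\<^sub>v t"]
          mult_mat_vec[OF g(1) tc, of c] tc by (simp add: t'(2) t(2)[symmetric])
      finally have z_eq: "z = coord k *\<^sub>v (t' + c \<cdot>\<^sub>v t)" .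
      have "t' + c \<cdot>\<^sub>v t \<in> S k" using S(3,4) t(1) t'(1) by blast
      moreover from this have "t' + c \<cdot>\<^sub>v t \<in> carrier_vec (v k)" using S(1) by blast
      then have "ginv v coord k *\<^sub>v z = t' + c \<cdot>\<^sub>v t"
        unfolding z_eq by (rule coord_inv(2))
      moreover have "ginv v coord k *\<^sub>v z = y"
        unfolding z_def by (rule coord_inv(2)[OF y(1)])
      ultimately show False using y(2) by metis
    qed
    with s show "s \<in> {s \<in> carrier_vec (v k). s $ u k = 0}" by simp
  qed (use hyp in blast)
  then have k: "gpush coord S k = gimage u (incl u v) k" by (simp only: gimage_incl_k)
  fix i
  show "gpush coord S i = gimage u (incl u v) i"
  proof (cases "i = k")
    case False
    have "gpush coord S i = carrier_vec (v i)"
    proof (intro equalityI subsetI)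
      fix s :: "complex Matrix.vec" assume "s \<in> carrier_vec (v i)"
      then show "s \<in> gpush coord S i"
        unfolding gpush_def full[OF False] using coord_inv(1,3)[of s i] by (metis imageI)
    next
      fix s assume "s \<in> gpush coord S i"
      then show "s \<in> carrier_vec (v i)"
        unfolding gpush_def full[OF False] using coord_inv(4) by blast
    qed
    then show ?thesis using gimage_incl_other[OF False] by simp
  qed (use k in simp)
qed

definition hecke_point where "hecke_point = triple_orbit v can_triple"

lemma hecke_eq: "hecke u w0 k = {hecke_point}"
proof -
  have "triple_orbit v T = hecke_point" if T: "T \<in> hecke_triples u w0 k" for T
  proof -
    obtain x j S where T_eq: "T = ((x, j), S)" by (metis surj_pair)
    have st: "(x, j) \<in> Lambda_st v w0" and "graded_subspace v S"
      using T by (auto simp: T_eq hecke_triples_def v[symmetric])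
    interpret stable_point v x j by standard (rule st)
    have "S i \<subseteq> carrier_vec (v i)" for i
      using \<open>graded_subspace v S\<close> by (simp add: graded_subspace_def subspace_module_vec_iff)
    from triple_orbit_act[where S = S, OF coord_in_G_V x_in_rep_space j_in_gmaps this]
    show ?thesis
      using act_coord coord_image_stable_subspace[OF T[unfolded T_eq]] by (simp add: hecke_point_def T_eq)
  qed
  then show ?thesis
    using can_triple_in_hecke_triples by (force simp: hecke_def v[symmetric])
qed

lemma \<pi>2_hecke_point: "\<pi>2 hecke_point = can_orbit v"
  by (auto simp: \<pi>2_def hecke_point_def triple_orbit_eq can_orbit_def orbit_of_def image_image)

text \<open>
  A frame \<open>\<iota>\<close> of a subspace in the class is moved into the canonical position by the inverse of
  \<open>g\<close>, where it differs from the standard inclusion by an automorphism \<open>a\<close> of the source. This \<open>a\<close> carries the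
  transported restriction to the canonical point of dimension \<open>u\<close>.
\<close>

lemma \<pi>1_hecke_point_subset: "\<pi>1 u w0 k hecke_point \<subseteq> can_orbit u"
proof
  fix p assume "p \<in> \<pi>1 u w0 k hecke_point"
  then obtain x' j' x j S \<iota> where p: "p = (x', j')" and x': "x' \<in> rep_space u" and j': "j' \<in> gmaps u w0"
    and hecke_point: "((x, j), S) \<in> hecke_point" and \<iota>: "\<iota> \<in> gframes u v" and im: "gimage u \<iota> = S"
    and x\<iota>: "\<And>h. x h * \<iota> (src h) = \<iota> (tgt h) * x' h" and j\<iota>: "\<And>i. j i * \<iota> i = j' i"
    unfolding \<pi>1_def v[symmetric] by blast
  obtain g where g: "g \<in> G_V v" and xj: "(x, j) = act v g (can_rep v, can_framing v)"
    and S: "S = gpush g (gimage u (incl u v))"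
    using hecke_point unfolding hecke_point_def triple_orbit_eq by auto
  note G = G_V_D[OF g]
  obtain x0 j0 where "act v g (can_rep v, can_framing v) = (x0, j0)" "x0 \<in> rep_space v" "j0 \<in> gmaps v w0"
    using act_closed[OF g can_rep_in_rep_space can_framing_in_gmaps] .
  then have x: "x \<in> rep_space v" and j: "j \<in> gmaps v w0" using xj by auto
  have gx: "g (tgt h) * can_rep v h = x h * g (src h)" and gj: "can_framing v i = j i * g i" for h i
    using act_eq_iff[OF g can_rep_in_rep_space x can_framing_in_gmaps j] xj by auto
  have \<iota>c: "\<iota> i \<in> carrier_mat (v i) (u i)" and \<iota>inj: "inj_on (\<lambda>s. \<iota> i *\<^sub>v s) (carrier_vec (u i))" for i
    using \<iota> by (auto simp: gframes_def gmaps_def)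
  note xc = rep_spaceD[OF x] and x'c = rep_spaceD[OF x']
  \<comment> \<open>the frame in the canonical position\<close>
  define b where "b i = ginv v g i * \<iota> i" for i
  have bc: "b i \<in> carrier_mat (v i) (u i)" for i
    unfolding b_def by (rule mult_carrier_mat[OF G(2) \<iota>c])
  have gb: "g i * b i = \<iota> i" for i
    unfolding b_def by (rule cancel_left_inverse[OF \<iota>c G(2,1,3)])
  have b_range: "b i *\<^sub>v t \<in> gimage u (incl u v) i" if t: "t \<in> carrier_vec (u i)" for i t
  proof -
    have "\<iota> i *\<^sub>v t \<in> S i" using t im by (auto simp: gimage_def)
    then obtain s where s: "s \<in> gimage u (incl u v) i" "\<iota> i *\<^sub>v t = g i *\<^sub>v s"
      by (auto simp: S gpush_def)
    have sc: "s \<in> carrier_vec (v i)" using s(1) frame_subspace(3)[OF incl_in_gframes] by blast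
    have "b i *\<^sub>v t = ginv v g i *\<^sub>v (\<iota> i *\<^sub>v t)"
      unfolding b_def by (rule assoc_mult_mat_vec[OF G(2) \<iota>c t])
    also have "\<dots> = ginv v g i * g i *\<^sub>v s"
      unfolding s(2) by (rule assoc_mult_mat_vec[OF G(2,1) sc, symmetric])
    also have "\<dots> = s" using sc by (simp only: G(4) one_mult_mat_vec)
    finally show ?thesis using s(1) by simp
  qed
  \<comment> \<open>the coordinates of \<open>b\<close> that need not vanish\<close>
  define a where "a i = rect_id (u i) (v i) * b i" for i
  have ac: "a i \<in> carrier_mat (u i) (u i)" for i
    using mult_carrier_mat[OF rect_id_carrier bc] by (simp add: a_def)
  have ia: "incl u v i * a i = b i" for i
  proof (rule eq_matI)
    fix r c assume "r < dim_row (b i)" "c < dim_col (b i)"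
    then have r: "r < v i" and c: "c < u i" using bc[of i] by auto
    have "b i *\<^sub>v unit_vec (u i) c = col (b i) c"
      using bc[of i] c by (intro eq_vecI) auto
    with b_range[of "unit_vec (u i) c" i] have zero: "u i \<le> r \<Longrightarrow> b i $$ (r, c) = 0"
      using r c bc[of i] by (auto simp: gimage_incl)
    have 1: "(incl u v i * a i) $$ (r, c) = (if r < u i then a i $$ (r, c) else 0)"
      unfolding incl_def by (rule rect_id_mult_mat[OF ac r c])
    have 2: "r < u i \<Longrightarrow> a i $$ (r, c) = b i $$ (r, c)"
      unfolding a_def using rect_id_mult_mat[OF bc _ c, of r "u i"] r by (simp only: if_True)
    show "(incl u v i * a i) $$ (r, c) = b i $$ (r, c)"
      using 1 2 zero by (cases "r < u i") (simp_all only: if_True if_False not_less)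
  qed (use bc[of i] ac[of i] incl_carrier[of i] in \<open>simp_all only: carrier_matD index_mult_mat\<close>)
  have a: "a \<in> G_V u"
    unfolding G_V_def
  proof (intro CollectI allI trivial_kernel_imp_Units_ring_mat ac)
    fix i z assume z: "z \<in> carrier_vec (u i)" "a i *\<^sub>v z = 0\<^sub>v (u i)"
    have \<iota>a: "\<iota> i *\<^sub>v s = g i *\<^sub>v (incl u v i *\<^sub>v (a i *\<^sub>v s))" if s: "s \<in> carrier_vec (u i)" for s
    proof -
      have "\<iota> i *\<^sub>v s = g i *\<^sub>v (b i *\<^sub>v s)"
        using assoc_mult_mat_vec[OF G(1)[of i] bc[of i] s] by (simp only: gb)
      also have "b i *\<^sub>v s = incl u v i *\<^sub>v (a i *\<^sub>v s)"
        using assoc_mult_mat_vec[OF incl_carrier[of i] ac[of i] s] by (simp only: ia)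
      finally show ?thesis .
    qed
    have "a i *\<^sub>v 0\<^sub>v (u i) = 0\<^sub>v (u i)"
    proof (rule eq_vecI)
      fix r assume "r < dim_vec (0\<^sub>v (u i) :: complex Matrix.vec)"
      then show "(a i *\<^sub>v 0\<^sub>v (u i)) $ r = 0\<^sub>v (u i) $ r"
        using mult_mat_vec_index_sum[OF ac[of i] zero_carrier_vec, of r] by simp
    qed (use ac[of i] in simp)
    then have "\<iota> i *\<^sub>v z = \<iota> i *\<^sub>v 0\<^sub>v (u i)"
      using \<iota>a[OF z(1)] \<iota>a[OF zero_carrier_vec] z(2) by (simp only:)
    then show "z = 0\<^sub>v (u i)"
      by (rule inj_onD[OF \<iota>inj]) (use z(1) in auto)
  qed
  have ax: "a (tgt h) * x' h = can_rep u h * a (src h)" for h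
  proof (rule rect_id_cancel[OF u_le_v])
    show "a (tgt h) * x' h \<in> carrier_mat (u (tgt h)) (u (src h))"
      by (rule mult_carrier_mat[OF ac x'c])
    show "can_rep u h * a (src h) \<in> carrier_mat (u (tgt h)) (u (src h))"
      by (rule mult_carrier_mat[OF can_rep_carrier ac])
    have "incl u v (tgt h) * (a (tgt h) * x' h) = b (tgt h) * x' h"
      using assoc_mult_mat[OF incl_carrier ac x'c] by (simp only: ia)
    also have "\<dots> = ginv v g (tgt h) * (x h * \<iota> (src h))"
      using assoc_mult_mat[OF G(2) \<iota>c x'c] by (simp only: b_def x\<iota>)
    also have "x h * \<iota> (src h) = x h * g (src h) * b (src h)"
      using assoc_mult_mat[OF xc G(1) bc] by (simp only: gb)
    also have "\<dots> = g (tgt h) * (can_rep v h * b (src h))"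
      using assoc_mult_mat[OF G(1) can_rep_carrier[of v h] bc] by (simp only: gx)
    also have "ginv v g (tgt h) * \<dots> = can_rep v h * b (src h)"
      by (rule cancel_left_inverse[OF mult_carrier_mat[OF can_rep_carrier bc] G(1,2,4)])
    also have "\<dots> = can_rep v h * incl u v (src h) * a (src h)"
      using assoc_mult_mat[OF can_rep_carrier[of v h] incl_carrier ac] by (simp only: ia)
    also have "\<dots> = incl u v (tgt h) * (can_rep u h * a (src h))"
      unfolding incl_intertwines by (rule assoc_mult_mat[OF incl_carrier can_rep_carrier[of u h] ac])
    finally show "rect_id (v (tgt h)) (u (tgt h)) * (a (tgt h) * x' h) =
        rect_id (v (tgt h)) (u (tgt h)) * (can_rep u h * a (src h))"
      by (simp only: incl_def)
  qed
  have aj: "j' i = can_framing u i * a i" for i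
  proof -
    have jc: "j i \<in> carrier_mat (w0 i) (v i)" and cc: "can_framing v i \<in> carrier_mat (w0 i) (v i)"
      using j by (auto simp: gmaps_def can_framing_def)
    have "j' i = j i * g i * b i"
      using assoc_mult_mat[OF jc G(1) bc] by (simp only: gb j\<iota>)
    also have "\<dots> = can_framing v i * incl u v i * a i"
      using assoc_mult_mat[OF cc incl_carrier ac] by (simp only: ia gj)
    finally show ?thesis by (simp only: can_framing_incl)
  qed
  have "act u a (x', j') = (can_rep u, can_framing u)"
    unfolding act_eq_iff[OF a x' can_rep_in_rep_space j' can_framing_in_gmaps] using ax aj by blast
  then have "can_orbit u = orbit_of u (x', j')"
    using orbit_of_act[OF a x' j'] by (simp add: can_orbit_def)
  moreover have "(x', j') \<in> orbit_of u (x', j')"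
    unfolding orbit_of_def using act_one[OF x' j'] one_in_G_V[of u] by (intro image_eqI) auto
  ultimately show "p \<in> can_orbit u" using p by simp
qed

text \<open>
  Conversely, a point that an automorphism \<open>a\<close> produces from the canonical point is the restriction
  to the same subspace with respect to the standard inclusion composed with the inverse of \<open>a\<close>.
\<close>

lemma can_orbit_subset_\<pi>1_hecke_point: "can_orbit u \<subseteq> \<pi>1 u w0 k hecke_point"
proof
  fix p assume "p \<in> can_orbit u"
  then obtain a where a: "a \<in> G_V u" "p = act u a (can_rep u, can_framing u)"
    by (auto simp: can_orbit_def orbit_of_def)
  note A = G_V_D[OF a(1)]
  obtain x' j' where eq: "act u a (can_rep u, can_framing u) = (x', j')"
    and x': "x' \<in> rep_space u" and j': "j' \<in> gmaps u w0"
    using act_closed[OF a(1) can_rep_in_rep_space can_framing_in_gmaps] .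
  have ax: "a (tgt h) * can_rep u h = x' h * a (src h)" and aj: "can_framing u i = j' i * a i" for h i
    using act_eq_iff[OF a(1) can_rep_in_rep_space x' can_framing_in_gmaps j'] eq by auto
  define \<iota> where "\<iota> i = incl u v i * ginv u a i" for i
  have \<iota>c: "\<iota> i \<in> carrier_mat (v i) (u i)" for i
    unfolding \<iota>_def by (rule mult_carrier_mat[OF incl_carrier A(2)])
  have \<iota>_vec: "\<iota> i *\<^sub>v s = incl u v i *\<^sub>v (ginv u a i *\<^sub>v s)" "ginv u a i *\<^sub>v s \<in> carrier_vec (u i)"
    "a i *\<^sub>v (ginv u a i *\<^sub>v s) = s" "ginv u a i *\<^sub>v (a i *\<^sub>v s) = s" "a i *\<^sub>v s \<in> carrier_vec (u i)"
    if s: "s \<in> carrier_vec (u i)" for i s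
    using assoc_mult_mat_vec[OF incl_carrier A(2) s] mult_mat_vec_carrier[OF A(2) s]
      mult_mat_vec_carrier[OF A(1) s] assoc_mult_mat_vec[OF A(1,2) s] assoc_mult_mat_vec[OF A(2,1) s]
      one_mult_mat_vec[OF s] by (simp_all only: \<iota>_def A(3,4))
  have "inj_on (\<lambda>s. \<iota> i *\<^sub>v s) (carrier_vec (u i))" for i
  proof (rule inj_onI)
    fix s t assume st: "s \<in> carrier_vec (u i)" "t \<in> carrier_vec (u i)" "\<iota> i *\<^sub>v s = \<iota> i *\<^sub>v t"
    then have "ginv u a i *\<^sub>v s = ginv u a i *\<^sub>v t"
      using inj_onD[OF inj_on_rect_id[OF u_le_v[of i]]] \<iota>_vec(1,2)[OF st(1)] \<iota>_vec(1,2)[OF st(2)]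
      unfolding incl_def by metis
    then show "s = t" using \<iota>_vec(3)[OF st(1)] \<iota>_vec(3)[OF st(2)] by metis
  qed
  then have \<iota>: "\<iota> \<in> gframes u v" using \<iota>c by (simp add: gframes_def gmaps_def)
  have "gimage u \<iota> i = gimage u (incl u v) i" for i
    unfolding gimage_def
  proof (intro equalityI subsetI)
    fix s assume "s \<in> (\<lambda>s. \<iota> i *\<^sub>v s) ` carrier_vec (u i)"
    then show "s \<in> (\<lambda>s. incl u v i *\<^sub>v s) ` carrier_vec (u i)"
      using \<iota>_vec(1,2) by blast
  next
    fix s assume "s \<in> (\<lambda>s. incl u v i *\<^sub>v s) ` carrier_vec (u i)"
    then obtain t where t: "t \<in> carrier_vec (u i)" "s = incl u v i *\<^sub>v t" by blast
    then have "s = \<iota> i *\<^sub>v (a i *\<^sub>v t)"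
      using \<iota>_vec(1)[OF \<iota>_vec(5)[OF t(1)]] \<iota>_vec(4)[OF t(1)] by simp
    then show "s \<in> (\<lambda>s. \<iota> i *\<^sub>v s) ` carrier_vec (u i)"
      using \<iota>_vec(5)[OF t(1)] by blast
  qed
  then have im: "gimage u \<iota> = gimage u (incl u v)" by blast
  have "can_rep v h * \<iota> (src h) = \<iota> (tgt h) * x' h" for h
  proof -
    note x'c = rep_spaceD[OF x', of h]
    have "can_rep v h * \<iota> (src h) = can_rep v h * incl u v (src h) * ginv u a (src h)"
      unfolding \<iota>_def by (rule assoc_mult_mat[OF can_rep_carrier[of v h] incl_carrier A(2), symmetric])
    also have "\<dots> = incl u v (tgt h) * (can_rep u h * ginv u a (src h))"
      unfolding incl_intertwines by (rule assoc_mult_mat[OF incl_carrier can_rep_carrier[of u h] A(2)])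
    also have "can_rep u h * ginv u a (src h) = ginv u a (tgt h) * (a (tgt h) * (can_rep u h * ginv u a (src h)))"
      by (rule cancel_left_inverse[symmetric, OF mult_carrier_mat[OF can_rep_carrier[of u h] A(2)] A(1,2,4)])
    also have "a (tgt h) * (can_rep u h * ginv u a (src h)) = x' h * a (src h) * ginv u a (src h)"
      using assoc_mult_mat[OF A(1) can_rep_carrier[of u h] A(2)] by (simp only: ax)
    also have "\<dots> = x' h"
      by (rule cancel_right_inverse[OF x'c A(1,2,3)])
    also have "incl u v (tgt h) * (ginv u a (tgt h) * x' h) = \<iota> (tgt h) * x' h"
      unfolding \<iota>_def by (rule assoc_mult_mat[OF incl_carrier A(2) x'c, symmetric])
    finally show ?thesis .
  qed
  moreover have "can_framing v i * \<iota> i = j' i" for i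
  proof -
    have cc: "can_framing v i \<in> carrier_mat (w0 i) (v i)" and jc: "j' i \<in> carrier_mat (w0 i) (u i)"
      using j' by (auto simp: gmaps_def can_framing_def)
    have "can_framing v i * \<iota> i = can_framing u i * ginv u a i"
      using assoc_mult_mat[OF cc incl_carrier A(2)] by (simp only: \<iota>_def can_framing_incl)
    also have "\<dots> = j' i"
      unfolding aj by (rule cancel_right_inverse[OF jc A(1,2,3)])
    finally show ?thesis .
  qed
  moreover have "can_triple \<in> hecke_point"
  proof -
    have "gpush (\<lambda>i. 1\<^sub>m (v i)) (gimage u (incl u v)) i = gimage u (incl u v) i" for i
    proof -
      have "1\<^sub>m (v i) *\<^sub>v s = s" if "s \<in> gimage u (incl u v) i" for s
        using frame_subspace(3)[OF incl_in_gframes, of i] that by (blast intro: one_mult_mat_vec)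
      then show ?thesis unfolding gpush_def by (force simp: image_iff)
    qed
    then have "gpush (\<lambda>i. 1\<^sub>m (v i)) (gimage u (incl u v)) = gimage u (incl u v)" by blast
    then show ?thesis
      unfolding hecke_point_def triple_orbit_eq
      using act_one[OF can_rep_in_rep_space can_framing_in_gmaps[of v]] one_in_G_V[of v]
      by (intro image_eqI) auto
  qed
  ultimately show "p \<in> \<pi>1 u w0 k hecke_point"
    unfolding \<pi>1_def v[symmetric] a(2) eq using x' j' \<iota> im by blast
qed

lemma \<pi>1_hecke_point: "\<pi>1 u w0 k hecke_point = can_orbit u"
  using \<pi>1_hecke_point_subset can_orbit_subset_\<pi>1_hecke_point by blast

end

section \<open>The operators\<close>

text \<open>
  The whole set of orbits is open, because every frame in the total space of the bundle spans a
  stable subspace of the correct dimension.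
\<close>

lemma topspace_hecke_topology: "topspace (hecke_topology u w k) = hecke u w k"
proof -
  let ?q = "\<lambda>(p, \<iota>). triple_orbit (raise k u) (p, gimage u \<iota>)"
  let ?X = "frame_topology u w k"
  have top: "topspace ?X = hecke_frames u w k"
    by (simp add: frame_topology_def topspace_pullback_topology)
  have "?q z \<in> hecke u w k" if z: "z \<in> hecke_frames u w k" for z
  proof -
    obtain x j \<iota> where eq: "z = ((x, j), \<iota>)" by (metis surj_pair)
    have "((x, j), gimage u \<iota>) \<in> hecke_triples u w k"
      using z frame_subspace(1,2)[of \<iota> u "raise k u"]
      by (simp add: eq hecke_frames_def hecke_triples_def)
    then show ?thesis by (simp add: eq hecke_def)
  qed
  then have "{z \<in> topspace ?X. ?q z \<in> hecke u w k} = topspace ?X"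
    unfolding top by blast
  then have "openin (hecke_topology u w k) (hecke u w k)"
    unfolding hecke_topology_def openin_quotient_topology by simp
  moreover have "U \<subseteq> hecke u w k" if "openin (hecke_topology u w k) U" for U
    using that unfolding hecke_topology_def openin_quotient_topology by blast
  ultimately show ?thesis
    using openin_subset openin_topspace by blast
qed

lemma pushforward_singleton:
  assumes T: "topspace T = {z}" and "\<pi> z = y"
  shows "pushforward T \<pi> f y = f z"
proof -
  have "{z' \<in> topspace T. \<pi> z' = y \<and> f z' = f z} = {z}"
    using assms by auto
  moreover have "topspace (subtopology T {z}) = {z}" using T by simp
  ultimately show ?thesis
    using euler_char_singleton[of "subtopology T {z}" z] by (simp add: pushforward_def T)
qed

lemma pushforward_zero: "pushforward T \<pi> (\<lambda>_. 0) y = 0"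
  by (auto simp: pushforward_def intro: sum.neutral)

context hecke_dims
begin

lemma topspace_hecke: "topspace (hecke_topology u w0 k) = {hecke_point}"
  by (simp add: topspace_hecke_topology hecke_eq)

lemma E_comp_eq: "y \<in> quiver_variety u w0 \<Longrightarrow> E_comp u w0 k f y = f (can_orbit v)"
  using quiver_variety_w0_subset[of u] pushforward_singleton[OF topspace_hecke, of "\<pi>1 u w0 k" "can_orbit u" "f \<circ> \<pi>2"]
  by (auto simp: E_comp_def \<pi>1_hecke_point \<pi>2_hecke_point)

lemma F_comp_eq: "y \<in> quiver_variety v w0 \<Longrightarrow> F_comp u w0 k f y = f (can_orbit u)"
  using quiver_variety_w0_subset[of v] pushforward_singleton[OF topspace_hecke, of \<pi>2 "can_orbit v" "f \<circ> \<pi>1 u w0 k"]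
  by (auto simp: F_comp_def \<pi>1_hecke_point \<pi>2_hecke_point v[symmetric])

end

lemma empty_constructible: "{} \<in> constructible_sets v w"
proof (rule constructible_sets.closed)
  show "zariski_closed v w {}"
    unfolding zariski_closed_def
    \<comment> \<open>the constant function $1$ has no zeros\<close>
    by (intro conjI exI[of _ "{\<lambda>_. 1}"]) (auto intro: regular_functions.const)
qed

lemma quiver_variety_constructible: "quiver_variety v w \<in> constructible_sets v w"
  using constructible_sets.compl[OF empty_constructible] by simp

lemma indicator_X_Y:
  "indicator (X_Y Y) (v, y) = (if v = young_gdim Y \<and> y \<in> quiver_variety v w0 then 1 else (0 :: complex))"
  by (auto simp: X_Y_def indicator_def)

lemma indicator_X_Y_total: "indicator (X_Y Y) \<in> total_functions w0"
proof -
  let ?f = "indicator (X_Y Y) :: gdim \<times> (qrep \<times> gmap) set \<Rightarrow> complex"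
  have "(\<lambda>y. ?f (v, y)) \<in> constructible_functions v w0" for v
  proof -
    have "finite (range (\<lambda>y. ?f (v, y)))"
      by (rule finite_subset[of _ "{0, 1}"]) (simp_all add: indicator_X_Y image_subset_iff)
    moreover have "{y \<in> quiver_variety v w0. ?f (v, y) = a} \<in> constructible_sets v w0" for a
    proof -
      have "{y \<in> quiver_variety v w0. ?f (v, y) = a} =
          (if (if v = young_gdim Y then 1 else 0) = a then quiver_variety v w0 else {})"
        unfolding indicator_X_Y by auto
      then show ?thesis
        using empty_constructible quiver_variety_constructible by simp
    qed
    ultimately show ?thesis
      by (simp add: constructible_functions_def indicator_X_Y)
  qed
  moreover have "finite {v. \<exists>y. ?f (v, y) \<noteq> 0}"
    by (rule finite_subset[of _ "{young_gdim Y}"]) (auto simp: indicator_X_Y)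
  moreover have "v \<notin> gdims \<longrightarrow> ?f (v, y) = 0" for v y
    using young_gdim_in_gdims by (auto simp: indicator_X_Y)
  ultimately show ?thesis
    unfolding total_functions_def by blast
qed

lemma raise_in_gdims_iff: "raise k u \<in> gdims \<longleftrightarrow> u \<in> gdims"
proof -
  have "{i. raise k u i \<noteq> 0} = insert k {i. u i \<noteq> 0}"
    by (auto simp: raise_def unit_gdim_def)
  then show ?thesis by (simp add: gdims_def)
qed

lemma lower_raise: "lower k (raise k u) = u"
  by (simp add: lower_def raise_def)

lemma raise_lower: "v k > 0 \<Longrightarrow> raise k (lower k v) = v"
  by (auto simp: lower_def raise_def unit_gdim_def)

lemma F_op_indicator:
  assumes Y: "Y \<in> young_diagrams"
  shows "F_op w0 k (indicator (X_Y Y)) (v, y) =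
    (if v = raise k (young_gdim Y) \<and> y \<in> quiver_variety v w0 then 1 else 0)"
proof (cases "v \<in> gdims \<and> v k > 0 \<and> y \<in> quiver_variety v w0")
  case True
  let ?u = "young_gdim Y"
  have F: "F_op w0 k (indicator (X_Y Y)) (v, y) =
      F_comp (lower k v) w0 k (\<lambda>z. indicator (X_Y Y) (lower k v, z)) y"
    using True indicator_X_Y_total by (simp add: F_op_def)
  show ?thesis
  proof (cases "lower k v = ?u")
    case eq: True
    then have v: "v = raise k ?u" using raise_lower[of v k] True by simp
    have adm: "admissible v" using True quiver_variety_w0_imp_admissible by blast
    interpret hecke_dims ?u k v
      using v adm young_gdim_admissible[OF Y] True by unfold_locales auto
    have "can_orbit ?u \<in> quiver_variety ?u w0"
      using quiver_variety_w0_eq[OF young_gdim_admissible[OF Y] young_gdim_in_gdims] by simp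
    then show ?thesis
      unfolding F eq using F_comp_eq[of y] True v by (simp add: indicator_X_Y)
  next
    case False
    then have "v \<noteq> raise k ?u" using lower_raise by metis
    moreover have "(\<lambda>z. indicator (X_Y Y) (lower k v, z)) = (\<lambda>_. 0 :: complex)"
      using False by (simp add: indicator_X_Y)
    ultimately show ?thesis
      unfolding F by (simp add: F_comp_def pushforward_zero comp_def)
  qed
next
  case False
  have "raise k (young_gdim Y) \<in> gdims"
    using young_gdim_in_gdims by (simp only: raise_in_gdims_iff)
  moreover have "raise k (young_gdim Y) k > 0"
    by (simp add: raise_def unit_gdim_def)
  moreover have "F_op w0 k (indicator (X_Y Y)) (v, y) = 0"
    using False indicator_X_Y_total raise_lower[of v k] by (auto simp: F_op_def F_comp_def)
  ultimately show ?thesis using False by auto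
qed

lemma E_op_indicator:
  assumes Y: "Y \<in> young_diagrams"
  shows "E_op w0 k (indicator (X_Y Y)) (u, y) =
    (if raise k u = young_gdim Y \<and> y \<in> quiver_variety u w0 then 1 else 0)"
proof (cases "u \<in> gdims \<and> y \<in> quiver_variety u w0")
  case True
  let ?v = "young_gdim Y"
  have E: "E_op w0 k (indicator (X_Y Y)) (u, y) =
      E_comp u w0 k (\<lambda>z. indicator (X_Y Y) (raise k u, z)) y"
    using True indicator_X_Y_total by (simp add: E_op_def)
  show ?thesis
  proof (cases "raise k u = ?v")
    case eq: True
    have adm: "admissible u" using True quiver_variety_w0_imp_admissible by blast
    interpret hecke_dims u k ?v
      using eq adm young_gdim_admissible[OF Y] young_gdim_in_gdims by unfold_locales auto
    have "can_orbit ?v \<in> quiver_variety ?v w0"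
      using quiver_variety_w0_eq[OF young_gdim_admissible[OF Y] young_gdim_in_gdims] by simp
    then show ?thesis
      unfolding E eq using E_comp_eq[of y] True by (simp add: indicator_X_Y)
  next
    case False
    then have "(\<lambda>z. indicator (X_Y Y) (raise k u, z)) = (\<lambda>_. 0 :: complex)"
      by (simp add: indicator_X_Y)
    with False show ?thesis
      unfolding E by (simp add: E_comp_def pushforward_zero comp_def)
  qed
next
  case False
  have "raise k u = young_gdim Y \<Longrightarrow> u \<in> gdims"
    using young_gdim_in_gdims raise_in_gdims_iff by metis
  moreover have "E_op w0 k (indicator (X_Y Y)) (u, y) = 0"
    using False indicator_X_Y_total by (auto simp: E_op_def E_comp_def)
  ultimately show ?thesis using False by auto
qed

text \<open>
  This is the bijection between diagrams and nonempty varieties in the direction that makes the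
  operators vanish when there is no neighbouring diagram.
\<close>

lemma quiver_variety_w0_nonempty_imp_young:
  assumes "v \<in> gdims" "y \<in> quiver_variety v w0"
  shows "\<exists>Y \<in> young_diagrams. young_gdim Y = v"
  using admissible_eq_young_gdim[OF quiver_variety_w0_imp_admissible assms(1)] assms(2) by blast

theorem proposition4p1p3:
  fixes Y :: "nat list" and k :: int
  assumes "Y \<in> young_diagrams"
  shows
    "(\<forall>Y' \<in> young_diagrams. (\<forall>i. young_gdim Y' i = young_gdim Y i + unit_gdim k i) \<longrightarrow>
        F_op w0 k (indicator (X_Y Y)) = indicator (X_Y Y')) \<and>
     ((\<nexists>Y'. Y' \<in> young_diagrams \<and> (\<forall>i. young_gdim Y' i = young_gdim Y i + unit_gdim k i)) \<longrightarrow>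
        F_op w0 k (indicator (X_Y Y)) = (\<lambda>_. 0)) \<and>
     (\<forall>Y'' \<in> young_diagrams.
        (\<forall>i. int (young_gdim Y'' i) = int (young_gdim Y i) - int (unit_gdim k i)) \<longrightarrow>
        E_op w0 k (indicator (X_Y Y)) = indicator (X_Y Y'')) \<and>
     ((\<nexists>Y''. Y'' \<in> young_diagrams \<and>
        (\<forall>i. int (young_gdim Y'' i) = int (young_gdim Y i) - int (unit_gdim k i))) \<longrightarrow>
        E_op w0 k (indicator (X_Y Y)) = (\<lambda>_. 0))"
proof -
  have up: "(\<forall>i. young_gdim Y' i = young_gdim Y i + unit_gdim k i) \<longleftrightarrow>
      young_gdim Y' = raise k (young_gdim Y)" for Y'
    by (simp add: raise_def fun_eq_iff)
  have down: "(\<forall>i. int (young_gdim Y'' i) = int (young_gdim Y i) - int (unit_gdim k i)) \<longleftrightarrow>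
      raise k (young_gdim Y'') = young_gdim Y" for Y''
  proof -
    have "int (young_gdim Y'' i) = int (young_gdim Y i) - int (unit_gdim k i) \<longleftrightarrow>
        young_gdim Y'' i + unit_gdim k i = young_gdim Y i" for i
      by linarith
    then show ?thesis by (simp add: raise_def fun_eq_iff)
  qed
  have F: "F_op w0 k (indicator (X_Y Y)) = indicator (X_Y Y')"
    if "young_gdim Y' = raise k (young_gdim Y)" for Y'
  proof (rule ext)
    fix p :: "gdim \<times> (qrep \<times> gmap) set"
    obtain v y where "p = (v, y)" by (cases p)
    then show "F_op w0 k (indicator (X_Y Y)) p = indicator (X_Y Y') p"
      using F_op_indicator[OF assms, of k v y] that by (simp add: indicator_X_Y)
  qed
  have F0: "F_op w0 k (indicator (X_Y Y)) = (\<lambda>_. 0)"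
    if none: "\<nexists>Y'. Y' \<in> young_diagrams \<and> young_gdim Y' = raise k (young_gdim Y)"
  proof (rule ext)
    fix p :: "gdim \<times> (qrep \<times> gmap) set"
    obtain v y where p: "p = (v, y)" by (cases p)
    have "\<not> (v = raise k (young_gdim Y) \<and> y \<in> quiver_variety v w0)"
      using none quiver_variety_w0_nonempty_imp_young[of v y] young_gdim_in_gdims[of Y]
        raise_in_gdims_iff by metis
    then show "F_op w0 k (indicator (X_Y Y)) p = 0"
      using F_op_indicator[OF assms, of k v y] p by simp
  qed
  have E: "E_op w0 k (indicator (X_Y Y)) = indicator (X_Y Y'')"
    if *: "raise k (young_gdim Y'') = young_gdim Y" for Y''
  proof (rule ext)
    fix p :: "gdim \<times> (qrep \<times> gmap) set"
    obtain u y where p: "p = (u, y)" by (cases p)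
    have "raise k u = young_gdim Y \<longleftrightarrow> u = young_gdim Y''"
      using * lower_raise by metis
    then show "E_op w0 k (indicator (X_Y Y)) p = indicator (X_Y Y'') p"
      using E_op_indicator[OF assms, of k u y] p by (simp add: indicator_X_Y)
  qed
  have E0: "E_op w0 k (indicator (X_Y Y)) = (\<lambda>_. 0)"
    if none: "\<nexists>Y''. Y'' \<in> young_diagrams \<and> raise k (young_gdim Y'') = young_gdim Y"
  proof (rule ext)
    fix p :: "gdim \<times> (qrep \<times> gmap) set"
    obtain u y where p: "p = (u, y)" by (cases p)
    have "\<not> (raise k u = young_gdim Y \<and> y \<in> quiver_variety u w0)"
      using none quiver_variety_w0_nonempty_imp_young[of u y] young_gdim_in_gdims[of Y]
        raise_in_gdims_iff by metis
    then show "E_op w0 k (indicator (X_Y Y)) p = 0"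
      using E_op_indicator[OF assms, of k u y] p by simp
  qed
  show ?thesis
    unfolding up down using F F0 E E0 by blast
qed

end
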